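(* Let $(R,\mathfrak{m})$ be a local ring and $M$ an $R$-module. The set of minimal primes in $\operatorname{CoSupp}(M)$ (i.e. minimal elements of $\operatorname{CoSupp}(M)$ with respect to inclusion) is finite if and only if $\operatorname{CoSupp}(M)$ is a closed subset of $\operatorname{Spec}R$ (in the Zariski topology).
   Context: All rings are commutative and Noetherian. Cosupport (in the sense of Richardson): for a local ring $R$, a prime ideal $\mathfrak{p}$ and an $R$-module $M$, put ${}^{\mathfrak{p}}M:=D_{R_{\mathfrak{p}}}(D_R(M)_{\mathfrak{p}})$, where $D_R$ and $D_{R_{\mathfrak{p}}}$ are the Matlis duals $\operatorname{Hom}(-,E)$ into the injective hull of the residue field over $R$ and $R_{\mathfrak{p}}$ respectively; $\operatorname{CoSupp}(M):=\{\mathfrak{p}\in\operatorname{Spec}(R) : {}^{\mathfrak{p}}M\neq0\}$. *)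

theory Defs
  imports "HOL-Algebra.Module" "HOL-Algebra.Ring_Divisibility" "HOL-Analysis.Abstract_Topology"
begin

section \<open>The prime spectrum\<close>

definition Spec :: "('a, 'r) ring_scheme \<Rightarrow> 'a set set" where
  "Spec R = {P. primeideal P R}"

definition zariski_V :: "('a, 'r) ring_scheme \<Rightarrow> 'a set \<Rightarrow> 'a set set" where
  "zariski_V R I = {P \<in> Spec R. I \<subseteq> P}"

definition zariski :: "('a, 'r) ring_scheme \<Rightarrow> 'a set topology" where
  "zariski R = topology (\<lambda>U. \<exists>I. ideal I R \<and> U = Spec R - zariski_V R I)"

definition minimal_primes :: "'a set set \<Rightarrow> 'a set set" where
  "minimal_primes C = {P \<in> C. \<forall>Q \<in> C. Q \<subseteq> P \<longrightarrow> Q = P}"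

definition local_ring :: "('a, 'r) ring_scheme \<Rightarrow> 'a set \<Rightarrow> bool" where
  "local_ring R \<mm> \<longleftrightarrow> cring R \<and> maximalideal \<mm> R \<and> (\<forall>J. maximalideal J R \<longrightarrow> J = \<mm>)"


section \<open>Modules of homomorphisms and quotients\<close>

text \<open>The record of \<^locale>\<open>module\<close> carries fields \<^const>\<open>monoid.mult\<close> and \<^const>\<open>monoid.one\<close>
  that mean nothing for a module; below they are mostly \<^const>\<open>undefined\<close>.
  Homomorphisms are extensional, so that equality of homomorphisms is equality on the
  carrier.\<close>

definition Hom :: "('a, 'r) ring_scheme \<Rightarrow> ('a, 'b, 'm) module_scheme \<Rightarrow> ('a, 'c, 'n) module_scheme
    \<Rightarrow> ('b \<Rightarrow> 'c) set" where
  "Hom R M N = {f \<in> carrier M \<rightarrow>\<^sub>E carrier N.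
     (\<forall>x \<in> carrier M. \<forall>y \<in> carrier M. f (x \<oplus>\<^bsub>M\<^esub> y) = f x \<oplus>\<^bsub>N\<^esub> f y) \<and>
     (\<forall>a \<in> carrier R. \<forall>x \<in> carrier M. f (a \<odot>\<^bsub>M\<^esub> x) = a \<odot>\<^bsub>N\<^esub> f x)}"

definition Hom_module :: "('a, 'r) ring_scheme \<Rightarrow> ('a, 'b, 'm) module_scheme
    \<Rightarrow> ('a, 'c, 'n) module_scheme \<Rightarrow> ('a, 'b \<Rightarrow> 'c) module" where
  "Hom_module R M N =
    \<lparr>carrier = Hom R M N, monoid.mult = undefined, one = undefined,
     ring.zero = (\<lambda>x\<in>carrier M. \<zero>\<^bsub>N\<^esub>),
     add = (\<lambda>f g. \<lambda>x\<in>carrier M. f x \<oplus>\<^bsub>N\<^esub> g x),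
     smult = (\<lambda>a f. \<lambda>x\<in>carrier M. a \<odot>\<^bsub>N\<^esub> f x)\<rparr>"

definition regular_module :: "('a, 'r) ring_scheme \<Rightarrow> ('a, 'a) module" where
  "regular_module R =
    \<lparr>carrier = carrier R, monoid.mult = monoid.mult R, one = \<one>\<^bsub>R\<^esub>, ring.zero = \<zero>\<^bsub>R\<^esub>, add = add R,
     smult = monoid.mult R\<rparr>"

text \<open>The ring \<open>R / I\<close> as an \<open>R\<close>-module.\<close>

definition quotient_module :: "('a, 'r) ring_scheme \<Rightarrow> 'a set \<Rightarrow> ('a, 'a set) module" where
  "quotient_module R I =
    ring.extend (R Quot I) \<lparr>smult = (\<lambda>a X. (I +>\<^bsub>R\<^esub> a) \<otimes>\<^bsub>R Quot I\<^esub> X)\<rparr>"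


section \<open>Localization\<close>

text \<open>The fraction \<open>x / s\<close> is the class of \<open>(x, s)\<close>, where \<open>(x, s)\<close> and \<open>(y, t)\<close> are
  identified if \<open>u (t x) = u (s y)\<close> for some \<open>u \<in> S\<close>. As for cosets, operations on fractions
  are unions over all representatives; for \<open>S\<close> multiplicatively closed the sets in these
  unions all coincide.\<close>

definition fraction :: "'a set \<Rightarrow> ('a, 'b, 'm) module_scheme \<Rightarrow> 'b \<Rightarrow> 'a \<Rightarrow> ('b \<times> 'a) set" where
  "fraction S M x s = {(y, t). y \<in> carrier M \<and> t \<in> S \<and>
     (\<exists>u \<in> S. u \<odot>\<^bsub>M\<^esub> (t \<odot>\<^bsub>M\<^esub> x) = u \<odot>\<^bsub>M\<^esub> (s \<odot>\<^bsub>M\<^esub> y))}"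

definition loc_ring :: "('a, 'r) ring_scheme \<Rightarrow> 'a set \<Rightarrow> ('a \<times> 'a) set ring" where
  "loc_ring R S =
    \<lparr>carrier = {fraction S (regular_module R) a s | a s. a \<in> carrier R \<and> s \<in> S},
     monoid.mult = (\<lambda>A B. \<Union>(a, s) \<in> A. \<Union>(b, t) \<in> B.
              fraction S (regular_module R) (a \<otimes>\<^bsub>R\<^esub> b) (s \<otimes>\<^bsub>R\<^esub> t)),
     one = fraction S (regular_module R) \<one>\<^bsub>R\<^esub> \<one>\<^bsub>R\<^esub>,
     ring.zero = fraction S (regular_module R) \<zero>\<^bsub>R\<^esub> \<one>\<^bsub>R\<^esub>,
     add = (\<lambda>A B. \<Union>(a, s) \<in> A. \<Union>(b, t) \<in> B.
              fraction S (regular_module R) ((t \<otimes>\<^bsub>R\<^esub> a) \<oplus>\<^bsub>R\<^esub> (s \<otimes>\<^bsub>R\<^esub> b)) (s \<otimes>\<^bsub>R\<^esub> t))\<rparr>"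

definition loc_module :: "('a, 'r) ring_scheme \<Rightarrow> 'a set \<Rightarrow> ('a, 'b, 'm) module_scheme
    \<Rightarrow> (('a \<times> 'a) set, ('b \<times> 'a) set) module" where
  "loc_module R S M =
    \<lparr>carrier = {fraction S M x s | x s. x \<in> carrier M \<and> s \<in> S},
     monoid.mult = undefined, one = undefined,
     ring.zero = fraction S M \<zero>\<^bsub>M\<^esub> \<one>\<^bsub>R\<^esub>,
     add = (\<lambda>X Y. \<Union>(x, s) \<in> X. \<Union>(y, t) \<in> Y.
              fraction S M ((t \<odot>\<^bsub>M\<^esub> x) \<oplus>\<^bsub>M\<^esub> (s \<odot>\<^bsub>M\<^esub> y)) (s \<otimes>\<^bsub>R\<^esub> t)),
     smult = (\<lambda>A X. \<Union>(a, s) \<in> A. \<Union>(x, t) \<in> X. fraction S M (a \<odot>\<^bsub>M\<^esub> x) (s \<otimes>\<^bsub>R\<^esub> t))\<rparr>"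

abbreviation prime_compl :: "('a, 'r) ring_scheme \<Rightarrow> 'a set \<Rightarrow> 'a set" where
  "prime_compl R P \<equiv> carrier R - P"

abbreviation ring_at :: "('a, 'r) ring_scheme \<Rightarrow> 'a set \<Rightarrow> ('a \<times> 'a) set ring" where
  "ring_at R P \<equiv> loc_ring R (prime_compl R P)"

abbreviation module_at :: "('a, 'r) ring_scheme \<Rightarrow> 'a set \<Rightarrow> ('a, 'b, 'm) module_scheme
    \<Rightarrow> (('a \<times> 'a) set, ('b \<times> 'a) set) module" where
  "module_at R P M \<equiv> loc_module R (prime_compl R P) M"

text \<open>The maximal ideal \<open>P R\<^sub>P\<close> of \<open>R\<^sub>P\<close>.\<close>

definition max_ideal_at :: "('a, 'r) ring_scheme \<Rightarrow> 'a set \<Rightarrow> ('a \<times> 'a) set set" where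
  "max_ideal_at R P = {fraction (prime_compl R P) (regular_module R) a s | a s. a \<in> P \<and> s \<in> prime_compl R P}"


section \<open>Injective hulls\<close>

text \<open>HOL cannot quantify over the types of the test modules \<open>B\<close>, so they range over the
  \<open>R\<close>-modules whose elements have the same type as those of \<open>R\<close>. This is no restriction:
  by Baer's criterion the lifting property then holds for test modules of every type, see
  \<open>injective_module_extends\<close> below.\<close>

definition injective_module :: "('a, 'r) ring_scheme \<Rightarrow> ('a, 'e, 'm) module_scheme \<Rightarrow> bool" where
  "injective_module R E \<longleftrightarrow> module R E \<and>
     (\<forall>(B :: ('a, 'a) module) N g.
        module R B \<and> submodule N R B \<and> g \<in> Hom R (B\<lparr>carrier := N\<rparr>) E \<longrightarrow>
        (\<exists>h \<in> Hom R B E. \<forall>x \<in> N. h x = g x))"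

definition essential_embedding :: "('a, 'r) ring_scheme \<Rightarrow> ('a, 'k, 'm) module_scheme
    \<Rightarrow> ('a, 'e, 'n) module_scheme \<Rightarrow> ('k \<Rightarrow> 'e) \<Rightarrow> bool" where
  "essential_embedding R K E \<phi> \<longleftrightarrow> \<phi> \<in> Hom R K E \<and> inj_on \<phi> (carrier K) \<and>
     (\<forall>N. submodule N R E \<and> N \<noteq> {\<zero>\<^bsub>E\<^esub>} \<longrightarrow> N \<inter> \<phi> ` carrier K \<noteq> {\<zero>\<^bsub>E\<^esub>})"

definition injective_hull :: "('a, 'r) ring_scheme \<Rightarrow> ('a, 'k, 'm) module_scheme
    \<Rightarrow> ('a, 'e, 'n) module_scheme \<Rightarrow> bool" where
  "injective_hull R K E \<longleftrightarrow> injective_module R E \<and> (\<exists>\<phi>. essential_embedding R K E \<phi>)"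


section \<open>Matlis duality and cosupport\<close>

text \<open>Injective hulls are only determined up to isomorphism. In the following \<open>E\<close> stands for a
  chosen injective hull of the residue field over the respective local ring, and \<open>F\<close> for a
  choice, for every prime \<open>P\<close> of \<open>R\<close>, of an injective hull of \<open>R\<^sub>P / P R\<^sub>P\<close> over \<open>R\<^sub>P\<close>.\<close>

definition matlis_dual :: "('a, 'r) ring_scheme \<Rightarrow> ('a, 'e, 'n) module_scheme
    \<Rightarrow> ('a, 'b, 'm) module_scheme \<Rightarrow> ('a, 'b \<Rightarrow> 'e) module" where
  "matlis_dual R E M = Hom_module R M E"

definition colocalization :: "('a, 'r) ring_scheme \<Rightarrow> ('a, 'e, 'n) module_scheme
    \<Rightarrow> ('a set \<Rightarrow> (('a \<times> 'a) set, 'f, 'l) module_scheme) \<Rightarrow> 'a set \<Rightarrow> ('a, 'b, 'm) module_scheme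
    \<Rightarrow> (('a \<times> 'a) set, (('b \<Rightarrow> 'e) \<times> 'a) set \<Rightarrow> 'f) module" where
  "colocalization R E F P M =
     matlis_dual (ring_at R P) (F P) (module_at R P (matlis_dual R E M))"

definition CoSupp :: "('a, 'r) ring_scheme \<Rightarrow> ('a, 'e, 'n) module_scheme
    \<Rightarrow> ('a set \<Rightarrow> (('a \<times> 'a) set, 'f, 'l) module_scheme) \<Rightarrow> ('a, 'b, 'm) module_scheme
    \<Rightarrow> 'a set set" where
  "CoSupp R E F M = {P \<in> Spec R.
     carrier (colocalization R E F P M) \<noteq> {\<zero>\<^bsub>colocalization R E F P M\<^esub>}}"


section \<open>Adequacy\<close>

context cring
begin

lemma Spec_sub_iff_Idl:
  assumes "A \<subseteq> carrier R" "P \<in> Spec R"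
  shows "Idl A \<subseteq> P \<longleftrightarrow> A \<subseteq> P"
proof -
  have "ideal P R" using assms(2) by (simp add: Spec_def primeideal_def)
  then show ?thesis using genideal_minimal genideal_self[OF assms(1)] by blast
qed

lemma zariski_istopology: "istopology (\<lambda>U. \<exists>I. ideal I R \<and> U = Spec R - zariski_V R I)"
  unfolding istopology_def
proof (intro conjI allI impI)
  fix S T
  assume "\<exists>I. ideal I R \<and> S = Spec R - zariski_V R I" "\<exists>I. ideal I R \<and> T = Spec R - zariski_V R I"
  then obtain I J where I: "ideal I R" "S = Spec R - zariski_V R I"
    and J: "ideal J R" "T = Spec R - zariski_V R J" by blast
  interpret I: ideal I R by fact
  interpret J: ideal J R by fact
  have "I \<inter> J \<subseteq> P \<longleftrightarrow> I \<subseteq> P \<or> J \<subseteq> P" if "P \<in> Spec R" for P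
  proof -
    interpret P: primeideal P R using that by (simp add: Spec_def)
    show ?thesis
    proof (rule iffI, rule ccontr)
      assume IJ: "I \<inter> J \<subseteq> P" and "\<not> (I \<subseteq> P \<or> J \<subseteq> P)"
      then obtain a b where ab: "a \<in> I" "a \<notin> P" "b \<in> J" "b \<notin> P" by blast
      then have "a \<in> carrier R" "b \<in> carrier R" using I.a_subset J.a_subset by auto
      with ab IJ show False
        using P.I_prime[of a b] I.I_r_closed[of a b] J.I_l_closed[of b a] by blast
    qed auto
  qed
  then have "S \<inter> T = Spec R - zariski_V R (I \<inter> J)"
    unfolding I J zariski_V_def by blast
  then show "\<exists>K. ideal K R \<and> S \<inter> T = Spec R - zariski_V R K"
    using i_intersect[OF I(1) J(1)] by blast
next
  fix \<K> :: "'a set set set"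
  assume "\<forall>K\<in>\<K>. \<exists>I. ideal I R \<and> K = Spec R - zariski_V R I"
  then obtain f where f: "\<And>K. K \<in> \<K> \<Longrightarrow> ideal (f K) R \<and> K = Spec R - zariski_V R (f K)"
    by metis
  let ?A = "\<Union>(f ` \<K>)"
  have A: "?A \<subseteq> carrier R"
    using f additive_subgroup.a_subset ideal.axioms(1) by blast
  have "zariski_V R (Idl ?A) = zariski_V R ?A"
    unfolding zariski_V_def using Spec_sub_iff_Idl[OF A] by blast
  moreover have "\<Union>\<K> = Spec R - zariski_V R ?A"
  proof -
    have "P \<in> \<Union>\<K> \<longleftrightarrow> P \<in> Spec R - zariski_V R ?A" for P
    proof
      assume "P \<in> \<Union>\<K>"
      then obtain K where "K \<in> \<K>" "P \<in> K" by blast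
      then show "P \<in> Spec R - zariski_V R ?A" using f[of K] unfolding zariski_V_def by blast
    next
      assume P: "P \<in> Spec R - zariski_V R ?A"
      then obtain K where "K \<in> \<K>" "\<not> f K \<subseteq> P" unfolding zariski_V_def by blast
      with P have "P \<in> K" using f[of K] unfolding zariski_V_def by blast
      with \<open>K \<in> \<K>\<close> show "P \<in> \<Union>\<K>" by blast
    qed
    then show ?thesis by blast
  qed
  ultimately show "\<exists>K. ideal K R \<and> \<Union>\<K> = Spec R - zariski_V R K"
    using genideal_ideal[OF A] by metis
qed

lemma openin_zariski: "openin (zariski R) U \<longleftrightarrow> (\<exists>I. ideal I R \<and> U = Spec R - zariski_V R I)"
  unfolding zariski_def using zariski_istopology by simp

lemma topspace_zariski: "topspace (zariski R) = Spec R"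
proof
  have "zariski_V R (carrier R) = {}"
    unfolding zariski_V_def Spec_def
    using primeideal.I_notcarr additive_subgroup.a_subset ideal.axioms(1) primeideal.axioms(1)
    by (metis (no_types, lifting) Collect_empty_eq mem_Collect_eq subset_antisym)
  then show "Spec R \<subseteq> topspace (zariski R)"
    using oneideal openin_zariski[of "Spec R"] openin_subset by (metis Diff_empty)
  show "topspace (zariski R) \<subseteq> Spec R"
    using openin_zariski[of "topspace (zariski R)"] openin_topspace by blast
qed

lemma closedin_zariski: "closedin (zariski R) C \<longleftrightarrow> (\<exists>I. ideal I R \<and> C = zariski_V R I)"
  unfolding closedin_def openin_zariski topspace_zariski zariski_V_def by blast

lemma regular_module: "module R (regular_module R)"
proof (rule moduleI)
  show "abelian_group (regular_module R)"
  proof (rule abelian_groupI)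
    fix x assume "x \<in> carrier (regular_module R)"
    then show "\<exists>y\<in>carrier (regular_module R). y \<oplus>\<^bsub>regular_module R\<^esub> x = \<zero>\<^bsub>regular_module R\<^esub>"
      by (auto simp: regular_module_def l_neg intro!: bexI[of _ "\<ominus> x"])
  qed (simp_all add: regular_module_def a_ac)
qed (simp_all add: regular_module_def cring_axioms l_distr r_distr m_assoc)

end

text \<open>Injectivity does not depend on the type of the test modules.\<close>

theorem injective_module_extends:
  fixes R :: "('a, 'r) ring_scheme" and B :: "('a, 'b, 'm) module_scheme"
    and E :: "('a, 'e, 'n) module_scheme"
  assumes inj: "injective_module R E" and "module R B" and "submodule N R B"
    and g: "g \<in> Hom R (B\<lparr>carrier := N\<rparr>) E"
  shows "\<exists>h \<in> Hom R B E. \<forall>x \<in> N. h x = g x"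
proof -
  interpret B: module R B by fact
  interpret E: module R E using inj by (simp add: injective_module_def)
  note N = B.submoduleE[OF \<open>submodule N R B\<close>]
  define ok where "ok G \<longleftrightarrow> G \<subseteq> carrier B \<times> carrier E \<and> single_valued G \<and>
    (\<forall>x y x' y'. (x, y) \<in> G \<longrightarrow> (x', y') \<in> G \<longrightarrow> (x \<oplus>\<^bsub>B\<^esub> x', y \<oplus>\<^bsub>E\<^esub> y') \<in> G) \<and>
    (\<forall>a x y. a \<in> carrier R \<longrightarrow> (x, y) \<in> G \<longrightarrow> (a \<odot>\<^bsub>B\<^esub> x, a \<odot>\<^bsub>E\<^esub> y) \<in> G)" for G
  define G0 where "G0 = (\<lambda>x. (x, g x)) ` N"
  have gN: "g x \<in> carrier E" if "x \<in> N" for x using g that by (auto simp: Hom_def)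
  have g_add: "g (x \<oplus>\<^bsub>B\<^esub> y) = g x \<oplus>\<^bsub>E\<^esub> g y" if "x \<in> N" "y \<in> N" for x y
    using g that by (auto simp: Hom_def)
  have g_smult: "g (a \<odot>\<^bsub>B\<^esub> x) = a \<odot>\<^bsub>E\<^esub> g x" if "a \<in> carrier R" "x \<in> N" for a x
    using g that by (auto simp: Hom_def)
  have ok0: "ok G0"
    unfolding ok_def G0_def single_valued_def
    using N(1) N(4,5) gN by (auto simp: g_add g_smult)
  define \<A> where "\<A> = {G. ok G \<and> G0 \<subseteq> G}"
  have "\<exists>G \<in> \<A>. \<forall>X \<in> \<A>. G \<subseteq> X \<longrightarrow> X = G"
  proof (rule subset_Zorn_nonempty)
    show "\<A> \<noteq> {}" using ok0 by (auto simp: \<A>_def)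
    fix \<C> assume ne: "\<C> \<noteq> {}" and ch: "subset.chain \<A> \<C>"
    have C: "ok X" "G0 \<subseteq> X" if "X \<in> \<C>" for X
      using ch that by (auto simp: subset.chain_def \<A>_def)
    have pair: "\<exists>X \<in> \<C>. p \<in> X \<and> q \<in> X" if "p \<in> \<Union>\<C>" "q \<in> \<Union>\<C>" for p q
    proof -
      from that obtain X Y where "X \<in> \<C>" "p \<in> X" "Y \<in> \<C>" "q \<in> Y" by blast
      moreover have "X \<subseteq> Y \<or> Y \<subseteq> X"
        using ch \<open>X \<in> \<C>\<close> \<open>Y \<in> \<C>\<close> by (auto simp: subset_chain_def)
      ultimately show ?thesis by blast
    qed
    have "ok (\<Union>\<C>)"
      unfolding ok_def
    proof (intro conjI allI impI)
      show "\<Union>\<C> \<subseteq> carrier B \<times> carrier E" using C(1) unfolding ok_def by blast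
      show "single_valued (\<Union>\<C>)"
        unfolding single_valued_def
      proof (intro allI impI)
        fix x y z assume "(x, y) \<in> \<Union>\<C>" "(x, z) \<in> \<Union>\<C>"
        from pair[OF this] obtain X where "X \<in> \<C>" "(x, y) \<in> X" "(x, z) \<in> X" by blast
        then show "y = z" using C(1)[of X] unfolding ok_def single_valued_def by blast
      qed
      fix x y
      { fix x' y' assume "(x, y) \<in> \<Union>\<C>" "(x', y') \<in> \<Union>\<C>"
        from pair[OF this] obtain X where "X \<in> \<C>" "(x, y) \<in> X" "(x', y') \<in> X" by blast
        then show "(x \<oplus>\<^bsub>B\<^esub> x', y \<oplus>\<^bsub>E\<^esub> y') \<in> \<Union>\<C>" using C(1)[of X] unfolding ok_def by blast }
      fix a assume "a \<in> carrier R" "(x, y) \<in> \<Union>\<C>"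
      then show "(a \<odot>\<^bsub>B\<^esub> x, a \<odot>\<^bsub>E\<^esub> y) \<in> \<Union>\<C>" using C(1) unfolding ok_def by blast
    qed
    then show "\<Union>\<C> \<in> \<A>" using ne C(2) by (auto simp: \<A>_def)
  qed
  then obtain G where GA: "G \<in> \<A>" and mx: "\<forall>X \<in> \<A>. G \<subseteq> X \<longrightarrow> X = G" by (rule bexE)
  have G: "ok G" "G0 \<subseteq> G" using GA by (simp_all add: \<A>_def)
  have max: "X = G" if "ok X" "G0 \<subseteq> X" "G \<subseteq> X" for X
    using mx that by (simp add: \<A>_def)
  have Gc: "x \<in> carrier B" "y \<in> carrier E" if "(x, y) \<in> G" for x y
    using G(1) that unfolding ok_def by auto
  have Gsv: "y = z" if "(x, y) \<in> G" "(x, z) \<in> G" for x y z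
    using G(1) that unfolding ok_def single_valued_def by blast
  have Gadd: "(x \<oplus>\<^bsub>B\<^esub> x', y \<oplus>\<^bsub>E\<^esub> y') \<in> G" if "(x, y) \<in> G" "(x', y') \<in> G" for x y x' y'
    using G(1) that unfolding ok_def by blast
  have Gsm: "(a \<odot>\<^bsub>B\<^esub> x, a \<odot>\<^bsub>E\<^esub> y) \<in> G" if "a \<in> carrier R" "(x, y) \<in> G" for a x y
    using G(1) that unfolding ok_def by blast
  have G_zero: "(\<zero>\<^bsub>B\<^esub>, \<zero>\<^bsub>E\<^esub>) \<in> G"
  proof -
    obtain n where "n \<in> N" using N(2) by blast
    then have "(n, g n) \<in> G" using G(2) by (auto simp: G0_def)
    from Gsm[OF B.R.zero_closed this] Gc[OF this] show ?thesis by simp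
  qed
  have Gneg: "(\<ominus>\<^bsub>B\<^esub> x, \<ominus>\<^bsub>E\<^esub> y) \<in> G" if "(x, y) \<in> G" for x y
    using Gsm[OF _ that, of "\<ominus>\<^bsub>R\<^esub> \<one>\<^bsub>R\<^esub>"] Gc[OF that] by (simp add: B.smult_l_minus E.smult_l_minus)
  have dom: "Domain G = carrier B"
  proof (rule ccontr)
    assume "Domain G \<noteq> carrier B"
    then obtain b where b: "b \<in> carrier B" "b \<notin> Domain G" using Gc by blast
    define I where "I = {r \<in> carrier R. r \<odot>\<^bsub>B\<^esub> b \<in> Domain G}"
    define k where "k = (\<lambda>r\<in>I. THE y. (r \<odot>\<^bsub>B\<^esub> b, y) \<in> G)"
    have k: "(r \<odot>\<^bsub>B\<^esub> b, k r) \<in> G" if r: "r \<in> I" for r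
    proof -
      obtain y where y: "(r \<odot>\<^bsub>B\<^esub> b, y) \<in> G" using r by (auto simp: I_def)
      then have "(THE y. (r \<odot>\<^bsub>B\<^esub> b, y) \<in> G) = y" using Gsv by blast
      with y r show ?thesis by (simp add: k_def)
    qed
    have Ic: "r \<in> carrier R" if "r \<in> I" for r using that by (simp add: I_def)
    have I_add: "r \<oplus>\<^bsub>R\<^esub> s \<in> I" "k (r \<oplus>\<^bsub>R\<^esub> s) = k r \<oplus>\<^bsub>E\<^esub> k s" if "r \<in> I" "s \<in> I" for r s
    proof -
      have *: "((r \<oplus>\<^bsub>R\<^esub> s) \<odot>\<^bsub>B\<^esub> b, k r \<oplus>\<^bsub>E\<^esub> k s) \<in> G"
        using Gadd[OF k[OF that(1)] k[OF that(2)]] Ic that b by (simp add: B.smult_l_distr)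
      then show "r \<oplus>\<^bsub>R\<^esub> s \<in> I" using Ic that by (auto simp: I_def)
      from Gsv[OF k[OF this] *] show "k (r \<oplus>\<^bsub>R\<^esub> s) = k r \<oplus>\<^bsub>E\<^esub> k s" .
    qed
    have I_sm: "a \<otimes>\<^bsub>R\<^esub> r \<in> I" "k (a \<otimes>\<^bsub>R\<^esub> r) = a \<odot>\<^bsub>E\<^esub> k r" if "a \<in> carrier R" "r \<in> I" for a r
    proof -
      have *: "((a \<otimes>\<^bsub>R\<^esub> r) \<odot>\<^bsub>B\<^esub> b, a \<odot>\<^bsub>E\<^esub> k r) \<in> G"
        using Gsm[OF that(1) k[OF that(2)]] Ic that b by (simp add: B.smult_assoc1)
      then show "a \<otimes>\<^bsub>R\<^esub> r \<in> I" using Ic that by (auto simp: I_def)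
      from Gsv[OF k[OF this] *] show "k (a \<otimes>\<^bsub>R\<^esub> r) = a \<odot>\<^bsub>E\<^esub> k r" .
    qed
    have I0: "\<zero>\<^bsub>R\<^esub> \<in> I" using G_zero b by (auto simp: I_def)
    interpret reg: module R "regular_module R" by (rule B.regular_module)
    have reg_simps: "carrier (regular_module R) = carrier R" "add (regular_module R) = add R"
      "ring.zero (regular_module R) = \<zero>\<^bsub>R\<^esub>" "smult (regular_module R) = monoid.mult R"
      by (simp_all add: regular_module_def)
    have neg: "\<ominus>\<^bsub>regular_module R\<^esub> r = \<ominus>\<^bsub>R\<^esub> r" for r
      by (simp add: a_inv_def m_inv_def reg_simps)
    have "submodule I R (regular_module R)"
    proof (rule reg.submoduleI)
      show "\<ominus>\<^bsub>regular_module R\<^esub> r \<in> I" if "r \<in> I" for r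
        using I_sm(1)[of "\<ominus>\<^bsub>R\<^esub> \<one>\<^bsub>R\<^esub>" r] Ic that by (simp add: neg B.l_minus)
    qed (use I0 I_add I_sm Ic in \<open>auto simp: reg_simps\<close>)
    moreover have "k \<in> Hom R ((regular_module R)\<lparr>carrier := I\<rparr>) E"
      unfolding Hom_def using I_add I_sm Gc(2)[OF k]
      by (auto simp: reg_simps PiE_def k_def extensional_def)
    ultimately obtain \<psi> where \<psi>: "\<psi> \<in> Hom R (regular_module R) E" "\<And>r. r \<in> I \<Longrightarrow> \<psi> r = k r"
      using inj B.regular_module unfolding injective_module_def by blast
    define e where "e = \<psi> \<one>\<^bsub>R\<^esub>"
    have e: "e \<in> carrier E" using \<psi>(1) by (auto simp: Hom_def reg_simps e_def)
    have ke: "k r = r \<odot>\<^bsub>E\<^esub> e" if "r \<in> I" for r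
    proof -
      have "\<psi> (r \<otimes>\<^bsub>R\<^esub> \<one>\<^bsub>R\<^esub>) = r \<odot>\<^bsub>E\<^esub> \<psi> \<one>\<^bsub>R\<^esub>"
        using \<psi>(1) Ic[OF that] unfolding Hom_def reg_simps by blast
      then show ?thesis using \<psi>(2)[OF that] Ic[OF that] by (simp add: e_def)
    qed
    define G' where "G' = {(x \<oplus>\<^bsub>B\<^esub> r \<odot>\<^bsub>B\<^esub> b, y \<oplus>\<^bsub>E\<^esub> r \<odot>\<^bsub>E\<^esub> e) | x y r. (x, y) \<in> G \<and> r \<in> carrier R}"
    have "single_valued G'"
      unfolding single_valued_def
    proof (intro allI impI)
      fix p q q' assume "(p, q) \<in> G'" "(p, q') \<in> G'"
      then obtain x y r x' y' r' where
        1: "(x, y) \<in> G" "r \<in> carrier R" "p = x \<oplus>\<^bsub>B\<^esub> r \<odot>\<^bsub>B\<^esub> b" "q = y \<oplus>\<^bsub>E\<^esub> r \<odot>\<^bsub>E\<^esub> e" and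
        2: "(x', y') \<in> G" "r' \<in> carrier R" "p = x' \<oplus>\<^bsub>B\<^esub> r' \<odot>\<^bsub>B\<^esub> b" "q' = y' \<oplus>\<^bsub>E\<^esub> r' \<odot>\<^bsub>E\<^esub> e"
        unfolding G'_def by blast
      note c = Gc[OF 1(1)] Gc[OF 2(1)] 1(2) 2(2) b(1) e
      have rr: "r \<ominus>\<^bsub>R\<^esub> r' \<in> carrier R" using c by simp
      have d: "(x' \<oplus>\<^bsub>B\<^esub> \<ominus>\<^bsub>B\<^esub> x, y' \<oplus>\<^bsub>E\<^esub> \<ominus>\<^bsub>E\<^esub> y) \<in> G" using Gadd[OF 2(1) Gneg[OF 1(1)]] .
      have eq: "x \<oplus>\<^bsub>B\<^esub> r \<odot>\<^bsub>B\<^esub> b = x' \<oplus>\<^bsub>B\<^esub> r' \<odot>\<^bsub>B\<^esub> b" using 1(3) 2(3) by simp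
      have "(r \<ominus>\<^bsub>R\<^esub> r') \<odot>\<^bsub>B\<^esub> b = r \<odot>\<^bsub>B\<^esub> b \<oplus>\<^bsub>B\<^esub> \<ominus>\<^bsub>B\<^esub> (r' \<odot>\<^bsub>B\<^esub> b)"
        using c by (simp add: a_minus_def B.smult_l_distr B.smult_l_minus)
      also have "r \<odot>\<^bsub>B\<^esub> b = \<ominus>\<^bsub>B\<^esub> x \<oplus>\<^bsub>B\<^esub> (x \<oplus>\<^bsub>B\<^esub> r \<odot>\<^bsub>B\<^esub> b)"
        using c by (simp add: B.M.r_neg1)
      also have "\<dots> = \<ominus>\<^bsub>B\<^esub> x \<oplus>\<^bsub>B\<^esub> (x' \<oplus>\<^bsub>B\<^esub> r' \<odot>\<^bsub>B\<^esub> b)" by (simp add: eq)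
      also have "\<dots> \<oplus>\<^bsub>B\<^esub> \<ominus>\<^bsub>B\<^esub> (r' \<odot>\<^bsub>B\<^esub> b) = x' \<oplus>\<^bsub>B\<^esub> \<ominus>\<^bsub>B\<^esub> x"
        using c B.M.r_neg[of "r' \<odot>\<^bsub>B\<^esub> b"] B.M.a_comm[of "\<ominus>\<^bsub>B\<^esub> x" x']
        by (simp add: B.M.a_assoc)
      finally have db: "(r \<ominus>\<^bsub>R\<^esub> r') \<odot>\<^bsub>B\<^esub> b = x' \<oplus>\<^bsub>B\<^esub> \<ominus>\<^bsub>B\<^esub> x" .
      then have rI: "r \<ominus>\<^bsub>R\<^esub> r' \<in> I" using d rr by (auto simp: I_def)
      have "(r \<ominus>\<^bsub>R\<^esub> r') \<odot>\<^bsub>E\<^esub> e = y' \<oplus>\<^bsub>E\<^esub> \<ominus>\<^bsub>E\<^esub> y"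
        using Gsv[OF k[OF rI]] d db ke[OF rI] by simp
      moreover have "r = (r \<ominus>\<^bsub>R\<^esub> r') \<oplus>\<^bsub>R\<^esub> r'"
        using c by (simp add: a_minus_def B.R.a_assoc B.R.l_neg)
      then have "r \<odot>\<^bsub>E\<^esub> e = (r \<ominus>\<^bsub>R\<^esub> r') \<odot>\<^bsub>E\<^esub> e \<oplus>\<^bsub>E\<^esub> r' \<odot>\<^bsub>E\<^esub> e"
        using E.smult_l_distr[OF rr 2(2) e] by simp
      ultimately have "q = y \<oplus>\<^bsub>E\<^esub> ((y' \<oplus>\<^bsub>E\<^esub> \<ominus>\<^bsub>E\<^esub> y) \<oplus>\<^bsub>E\<^esub> r' \<odot>\<^bsub>E\<^esub> e)" using 1(4) by simp
      also have "\<dots> = (y \<oplus>\<^bsub>E\<^esub> (\<ominus>\<^bsub>E\<^esub> y \<oplus>\<^bsub>E\<^esub> y')) \<oplus>\<^bsub>E\<^esub> r' \<odot>\<^bsub>E\<^esub> e"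
        using c E.M.a_comm[of "\<ominus>\<^bsub>E\<^esub> y" y'] by (simp add: E.M.a_assoc)
      also have "\<dots> = q'" using c 2(4) by (simp add: E.M.r_neg2)
      finally show "q = q'" .
    qed
    moreover have "G' \<subseteq> carrier B \<times> carrier E" using Gc b e unfolding G'_def by auto
    moreover have "(p \<oplus>\<^bsub>B\<^esub> p', q \<oplus>\<^bsub>E\<^esub> q') \<in> G'" if "(p, q) \<in> G'" "(p', q') \<in> G'" for p q p' q'
    proof -
      from that obtain x y r x' y' r' where
        1: "(x, y) \<in> G" "r \<in> carrier R" "p = x \<oplus>\<^bsub>B\<^esub> r \<odot>\<^bsub>B\<^esub> b" "q = y \<oplus>\<^bsub>E\<^esub> r \<odot>\<^bsub>E\<^esub> e" and
        2: "(x', y') \<in> G" "r' \<in> carrier R" "p' = x' \<oplus>\<^bsub>B\<^esub> r' \<odot>\<^bsub>B\<^esub> b" "q' = y' \<oplus>\<^bsub>E\<^esub> r' \<odot>\<^bsub>E\<^esub> e"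
        unfolding G'_def by blast
      note c = Gc[OF 1(1)] Gc[OF 2(1)] 1(2) 2(2) b(1) e
      have "p \<oplus>\<^bsub>B\<^esub> p' = (x \<oplus>\<^bsub>B\<^esub> x') \<oplus>\<^bsub>B\<^esub> (r \<oplus>\<^bsub>R\<^esub> r') \<odot>\<^bsub>B\<^esub> b"
        using c 1 2 by (simp add: B.smult_l_distr B.M.a_ac)
      moreover have "q \<oplus>\<^bsub>E\<^esub> q' = (y \<oplus>\<^bsub>E\<^esub> y') \<oplus>\<^bsub>E\<^esub> (r \<oplus>\<^bsub>R\<^esub> r') \<odot>\<^bsub>E\<^esub> e"
        using c 1 2 by (simp add: E.smult_l_distr E.M.a_ac)
      ultimately show ?thesis
        unfolding G'_def using Gadd[OF 1(1) 2(1)] B.R.a_closed[OF 1(2) 2(2)] by blast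
    qed
    moreover have "(a \<odot>\<^bsub>B\<^esub> p, a \<odot>\<^bsub>E\<^esub> q) \<in> G'" if a: "a \<in> carrier R" and "(p, q) \<in> G'" for a p q
    proof -
      from that obtain x y r where
        1: "(x, y) \<in> G" "r \<in> carrier R" "p = x \<oplus>\<^bsub>B\<^esub> r \<odot>\<^bsub>B\<^esub> b" "q = y \<oplus>\<^bsub>E\<^esub> r \<odot>\<^bsub>E\<^esub> e"
        unfolding G'_def by blast
      note c = Gc[OF 1(1)] 1(2) b(1) e a
      have "a \<odot>\<^bsub>B\<^esub> p = a \<odot>\<^bsub>B\<^esub> x \<oplus>\<^bsub>B\<^esub> (a \<otimes>\<^bsub>R\<^esub> r) \<odot>\<^bsub>B\<^esub> b" "a \<odot>\<^bsub>E\<^esub> q = a \<odot>\<^bsub>E\<^esub> y \<oplus>\<^bsub>E\<^esub> (a \<otimes>\<^bsub>R\<^esub> r) \<odot>\<^bsub>E\<^esub> e"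
        using c 1 by (simp_all add: B.smult_r_distr E.smult_r_distr B.smult_assoc1 E.smult_assoc1)
      then show ?thesis
        unfolding G'_def using Gsm[OF a 1(1)] B.R.m_closed[OF a 1(2)] by blast
    qed
    ultimately have ok': "ok G'" unfolding ok_def by blast
    have sub: "G \<subseteq> G'"
    proof
      fix p assume p: "p \<in> G"
      obtain x y where xy: "p = (x, y)" by fastforce
      have xyG: "(x, y) \<in> G" using p unfolding xy .
      have "(x \<oplus>\<^bsub>B\<^esub> \<zero>\<^bsub>R\<^esub> \<odot>\<^bsub>B\<^esub> b, y \<oplus>\<^bsub>E\<^esub> \<zero>\<^bsub>R\<^esub> \<odot>\<^bsub>E\<^esub> e) \<in> G'"
        unfolding G'_def using xyG B.R.zero_closed by blast
      then show "p \<in> G'"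
        unfolding xy B.smult_l_null[OF b(1)] E.smult_l_null[OF e]
          B.M.r_zero[OF Gc(1)[OF xyG]] E.M.r_zero[OF Gc(2)[OF xyG]] .
    qed
    have "G' = G" using max[OF ok' _ sub] G(2) sub by blast
    moreover have "(\<zero>\<^bsub>B\<^esub> \<oplus>\<^bsub>B\<^esub> \<one>\<^bsub>R\<^esub> \<odot>\<^bsub>B\<^esub> b, \<zero>\<^bsub>E\<^esub> \<oplus>\<^bsub>E\<^esub> \<one>\<^bsub>R\<^esub> \<odot>\<^bsub>E\<^esub> e) \<in> G'"
      unfolding G'_def using G_zero B.R.one_closed by blast
    ultimately have "(b, e) \<in> G" using b e by simp
    then show False using b by blast
  qed
  define h where "h = (\<lambda>x\<in>carrier B. THE y. (x, y) \<in> G)"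
  have h: "(x, h x) \<in> G" if x: "x \<in> carrier B" for x
  proof -
    obtain y where y: "(x, y) \<in> G" using x dom by blast
    then have "(THE y. (x, y) \<in> G) = y" using Gsv by blast
    with y x show ?thesis by (simp add: h_def)
  qed
  have "h (x \<oplus>\<^bsub>B\<^esub> y) = h x \<oplus>\<^bsub>E\<^esub> h y" if "x \<in> carrier B" "y \<in> carrier B" for x y
    using Gsv[OF h Gadd[OF h h]] that by simp
  moreover have "h (a \<odot>\<^bsub>B\<^esub> x) = a \<odot>\<^bsub>E\<^esub> h x" if "a \<in> carrier R" "x \<in> carrier B" for a x
    using Gsv[OF h Gsm[OF _ h]] that by simp
  ultimately have "h \<in> Hom R B E"
    unfolding Hom_def using Gc(2)[OF h] by (auto simp: PiE_def h_def extensional_def)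
  moreover have "h x = g x" if "x \<in> N" for x
    using Gsv[OF h[of x]] G(2) that N(1) by (auto simp: G0_def)
  ultimately show ?thesis by blast
qed

end

theory Submission
  imports Defs
begin

text \<open>
  The outer dual in the definition of \<open>\<^sup>PM\<close> is a Matlis dual over the local ring \<open>R\<^sub>P\<close>, and such a dual
  vanishes only on the zero module: every nonzero module has a cyclic submodule \<open>R\<^sub>P z\<close>, which maps onto
  the residue field, and this map extends to a nonzero map into the injective hull
  (\<open>Hom_into_hull_nonzero_iff\<close>). Hence the cosupport of \<open>M\<close> is the support of the \<open>R\<close>-module
  \<open>D = Hom(M, E)\<close>: a prime \<open>P\<close> belongs to it iff some \<open>f \<in> D\<close> is killed by no element outside \<open>P\<close>
  (\<open>mem_CoSupp_iff\<close>). This condition passes to larger primes, so the cosupport is closed under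
  specialization. The rest holds for every specialization-closed set \<open>C\<close> of primes of a Noetherian ring
  (\<open>finite_minimal_primes_iff_closedin\<close>).

  If \<open>C = V(I)\<close>, its minimal elements are the minimal primes over \<open>I\<close>, and there are finitely many.
  Conversely, if \<open>C\<close> has finitely many minimal elements, it should be the union of the closed sets \<open>V(P)\<close>
  over these \<open>P\<close>. For this every member of \<open>C\<close> must contain a minimal one, which needs the descending
  chain condition for primes. The heart of the matter is therefore Krull's height theorem: below a prime generated by \<open>n\<close> elements, chains of primes have at most \<open>n\<close>
  steps. It follows from the principal ideal theorem (\<open>exists_prime_between\<close>), which allows the primes in
  a chain to be exchanged for primes containing a given element of the top prime, at the cost of one step
  per element.
\<close>

section \<open>Noetherian rings and saturated ideals\<close>

locale noetherian_cring = noetherian_ring R + cring R for R (structure)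
begin

text \<open>For a property \<open>\<Phi>\<close> that fails somewhere, the ideals where it fails contain a maximal one: the union
of a nonempty chain of ideals of a Noetherian ring is a member of the chain.\<close>

lemma noetherian_induct [consumes 1, case_names step]:
  assumes "ideal I R"
    and step: "\<And>I. ideal I R \<Longrightarrow> (\<And>J. ideal J R \<Longrightarrow> I \<subset> J \<Longrightarrow> \<Phi> J) \<Longrightarrow> \<Phi> I"
  shows "\<Phi> I"
proof (rule ccontr)
  let ?B = "{I. ideal I R \<and> \<not> \<Phi> I}"
  assume "\<not> \<Phi> I"
  with assms(1) have "?B \<noteq> {}" by blast
  moreover have "\<Union>C \<in> ?B" if "C \<noteq> {}" "subset.chain ?B C" for C
  proof -
    have "subset.chain {I. ideal I R} C"
      using that(2) by (auto simp: subset_chain_def)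
    then have "\<Union>C \<in> C" by (rule ideal_chain_is_trivial[OF that(1)])
    with that(2) show ?thesis by (auto simp: subset_chain_def)
  qed
  ultimately obtain K where "K \<in> ?B" "\<forall>J\<in>?B. K \<subseteq> J \<longrightarrow> J = K"
    using subset_Zorn_nonempty[of ?B] by blast
  then show False using step[of K] by blast
qed

end

context cring
begin

definition adjoin :: "'a set \<Rightarrow> 'a \<Rightarrow> 'a set" where
  "adjoin I a = I <+>\<^bsub>R\<^esub> PIdl a"

lemma mem_adjoin_iff: "r \<in> adjoin I a \<longleftrightarrow> (\<exists>i\<in>I. \<exists>c\<in>carrier R. r = i \<oplus> c \<otimes> a)"
  unfolding adjoin_def set_add_def' cgenideal_def by blast

lemma adjoin_ideal:
  assumes "ideal I R" "a \<in> carrier R"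
  shows "ideal (adjoin I a) R" "I \<subseteq> adjoin I a" "a \<in> adjoin I a"
proof -
  interpret I: ideal I R by fact
  show "ideal (adjoin I a) R" unfolding adjoin_def by (intro add_ideals cgenideal_ideal assms)
  show "I \<subseteq> adjoin I a"
  proof
    fix i assume "i \<in> I"
    then show "i \<in> adjoin I a"
      unfolding mem_adjoin_iff using assms by (intro bexI[of _ i] bexI[of _ \<zero>]) auto
  qed
  show "a \<in> adjoin I a"
    unfolding mem_adjoin_iff using assms by (intro bexI[of _ \<zero>] bexI[of _ \<one>]) auto
qed

lemma adjoin_mono: "I \<subseteq> J \<Longrightarrow> adjoin I a \<subseteq> adjoin J a"
  unfolding adjoin_def set_add_def' by blast

lemma ideal_colon:
  assumes "ideal I R" "a \<in> carrier R"
  shows "ideal {r \<in> carrier R. r \<otimes> a \<in> I} R"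
proof -
  interpret I: ideal I R by fact
  show ?thesis
  proof (rule idealI[OF ring_axioms])
    show "subgroup {r \<in> carrier R. r \<otimes> a \<in> I} (add_monoid R)"
    proof (rule add.subgroupI)
      show "{r \<in> carrier R. r \<otimes> a \<in> I} \<noteq> {}" using assms(2) by (auto intro!: exI[of _ \<zero>])
    qed (use assms(2) in \<open>auto simp: l_distr l_minus\<close>)
  qed (use assms(2) in \<open>auto simp: m_assoc m_comm[of a] intro: I.I_l_closed\<close>,
       metis I.I_l_closed assms(2) m_assoc m_comm)
qed

end

text \<open>The preimage in \<open>R\<close> of \<open>I R\<^sub>P\<close>. Saturated ideals stand in for the ideals of \<open>R\<^sub>P\<close>, which makes it
possible to argue locally at a prime \<open>P\<close> without leaving \<open>R\<close>.\<close>

definition saturation :: "('a, 'r) ring_scheme \<Rightarrow> 'a set \<Rightarrow> 'a set \<Rightarrow> 'a set" where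
  "saturation R P I = {r \<in> carrier R. \<exists>s\<in>carrier R - P. s \<otimes>\<^bsub>R\<^esub> r \<in> I}"

definition saturated :: "('a, 'r) ring_scheme \<Rightarrow> 'a set \<Rightarrow> 'a set \<Rightarrow> bool" where
  "saturated R P I \<longleftrightarrow> ideal I R \<and> (\<forall>s\<in>carrier R - P. \<forall>r\<in>carrier R. s \<otimes>\<^bsub>R\<^esub> r \<in> I \<longrightarrow> r \<in> I)"

context primeideal
begin

lemma compl_mult: "s \<in> carrier R - I \<Longrightarrow> t \<in> carrier R - I \<Longrightarrow> s \<otimes> t \<in> carrier R - I"
  using I_prime by blast

lemma one_notin: "\<one> \<notin> I"
  using one_imp_carrier I_notcarr by blast

lemma saturation_saturated:
  assumes "ideal J R"
  shows "saturated R I (saturation R I J)" "J \<subseteq> saturation R I J"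
proof -
  interpret J: ideal J R by fact
  have 1: "\<one> \<in> carrier R - I" using one_notin by simp
  show J: "J \<subseteq> saturation R I J" unfolding saturation_def using 1 J.Icarr by force
  have "ideal (saturation R I J) R"
  proof (rule idealI[OF ring_axioms])
    show "subgroup (saturation R I J) (add_monoid R)"
    proof (rule add.subgroupI)
      show "saturation R I J \<noteq> {}" using J J.zero_closed by blast
      fix a assume a: "a \<in> saturation R I J"
      then obtain s where s: "s \<in> carrier R - I" "s \<otimes> a \<in> J" "a \<in> carrier R"
        unfolding saturation_def by blast
      then have "s \<otimes> \<ominus> a \<in> J" using J.a_inv_closed[of "s \<otimes> a"] by (simp add: r_minus)
      with s show "\<ominus> a \<in> saturation R I J" unfolding saturation_def by blast
      fix b assume "b \<in> saturation R I J"
      then obtain t where t: "t \<in> carrier R - I" "t \<otimes> b \<in> J" "b \<in> carrier R"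
        unfolding saturation_def by blast
      have "(s \<otimes> t) \<otimes> (a \<oplus> b) = t \<otimes> (s \<otimes> a) \<oplus> s \<otimes> (t \<otimes> b)"
        using s t by (simp add: r_distr m_ac)
      then have "(s \<otimes> t) \<otimes> (a \<oplus> b) \<in> J"
        using J.I_l_closed s t by simp
      then show "a \<oplus> b \<in> saturation R I J"
        unfolding saturation_def using compl_mult[OF s(1) t(1)] s t by blast
    qed (auto simp: saturation_def)
    fix a x assume a: "a \<in> saturation R I J" and x: "x \<in> carrier R"
    then obtain s where s: "s \<in> carrier R - I" "s \<otimes> a \<in> J" "a \<in> carrier R"
      unfolding saturation_def by blast
    have "s \<otimes> (x \<otimes> a) = x \<otimes> (s \<otimes> a)" using s x by (simp add: m_ac)
    then have "s \<otimes> (x \<otimes> a) \<in> J" using J.I_l_closed s x by simp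
    then show "x \<otimes> a \<in> saturation R I J" unfolding saturation_def using s x by blast
    then show "a \<otimes> x \<in> saturation R I J" using m_comm s x by simp
  qed
  moreover have "r \<in> saturation R I J"
    if sr: "s \<in> carrier R - I" "r \<in> carrier R" "s \<otimes> r \<in> saturation R I J" for s r
  proof -
    obtain t where t: "t \<in> carrier R - I" "t \<otimes> (s \<otimes> r) \<in> J"
      using sr unfolding saturation_def by blast
    then have "(t \<otimes> s) \<otimes> r \<in> J" using sr by (simp add: m_assoc)
    then show ?thesis unfolding saturation_def using compl_mult[OF t(1) sr(1)] sr by blast
  qed
  ultimately show "saturated R I (saturation R I J)" unfolding saturated_def by blast
qed

end

lemma saturation_mono: "I \<subseteq> J \<Longrightarrow> saturation R P I \<subseteq> saturation R P J"
  unfolding saturation_def by blast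

lemma saturatedD:
  assumes "saturated R P I"
  shows "ideal I R"
    "\<And>s r. s \<in> carrier R \<Longrightarrow> s \<notin> P \<Longrightarrow> r \<in> carrier R \<Longrightarrow> s \<otimes>\<^bsub>R\<^esub> r \<in> I \<Longrightarrow> r \<in> I"
  using assms unfolding saturated_def by blast+

lemma saturated_antimono: "saturated R Q I \<Longrightarrow> Q \<subseteq> P \<Longrightarrow> saturated R P I"
  unfolding saturated_def by blast

lemma saturation_least: "saturated R P J \<Longrightarrow> I \<subseteq> J \<Longrightarrow> saturation R P I \<subseteq> J"
  unfolding saturation_def saturated_def by blast

lemma (in cring) saturated_eq_carrier:
  assumes "saturated R P I" "\<not> I \<subseteq> P"
  shows "I = carrier R"
proof -
  interpret I: ideal I R using assms(1) by (rule saturatedD)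
  obtain s where s: "s \<in> I" "s \<notin> P" using assms(2) by blast
  then have "s \<in> carrier R" by simp
  then have "\<one> \<in> I" using saturatedD(2)[OF assms(1), of s \<one>] s by simp
  then show ?thesis by (rule I.one_imp_carrier)
qed

text \<open>If \<open>P\<close> is minimal over \<open>J\<close> then \<open>R\<^sub>P / J R\<^sub>P\<close> is Artinian. Noetherian induction on \<open>J\<close> replaces the
usual length argument. A prime \<open>J\<close> inside \<open>P\<close> equals \<open>P\<close>, and the only saturated ideals above it are \<open>P\<close> and
\<open>R\<close>. If \<open>J\<close> is not prime, \<open>a b \<in> J\<close> with \<open>a\<close>, \<open>b\<close> outside \<open>J\<close>. The saturations of \<open>I n + (a)\<close> and the ideals \<open>(I n : a)\<close>
lie above the strictly larger ideals \<open>J + (a)\<close> and \<open>(J : a)\<close>, the latter containing \<open>b\<close>; so both become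
stationary. Together they determine \<open>I n\<close> inside \<open>I N\<close>.\<close>

lemma (in noetherian_cring) saturated_dcc:
  assumes "ideal J R" "primeideal P R"
    and "\<And>Q. primeideal Q R \<Longrightarrow> J \<subseteq> Q \<Longrightarrow> Q \<subseteq> P \<Longrightarrow> Q = P"
    and "\<And>n. saturated R P (I n)" "\<And>n::nat. J \<subseteq> I n" "decseq I"
  shows "\<exists>N. \<forall>n\<ge>N. I n = I N"
  using assms(1,3-6)
proof (induction J arbitrary: I rule: noetherian_induct)
  case (step J)
  interpret P: primeideal P R by fact
  interpret J: ideal J R by fact
  note sat = step.prems(2) and JI = step.prems(3) and dec = step.prems(4)
  have decI: "I n \<subseteq> I m" if "m \<le> n" for m n using decseqD[OF dec that] .
  have idI: "ideal (I n) R" for n using sat by (rule saturatedD)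
  show ?case
  proof (cases "\<exists>n. I n \<subseteq> P")
    case False
    then have "I n = carrier R" for n using saturated_eq_carrier[OF sat] by blast
    then show ?thesis by simp
  next
    case True
    then obtain k where k: "I k \<subseteq> P" by blast
    \<comment> \<open>A saturated ideal other than \<open>R\<close> lies in \<open>P\<close>, so the induction only concerns ideals inside \<open>P\<close>.\<close>
    have JP: "J \<subseteq> P" using JI[of k] k by blast
    show ?thesis
    proof (cases "primeideal J R")
      case True
      then have "J = P" using step.prems(1) JP by blast
      then have "I n = P" if "n \<ge> k" for n using k JI[of n] decI[OF that] by blast
      then show ?thesis by (metis order_refl)
    next
      case False
      have "carrier R \<noteq> J" using JP P.one_notin by blast
      with False obtain a b where ab: "a \<in> carrier R" "b \<in> carrier R" "a \<otimes> b \<in> J" "a \<notin> J" "b \<notin> J"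
        using J.primeidealCD[OF is_cring] by blast
      define A where "A n = saturation R P (adjoin (I n) a)" for n
      define C where "C n = {r \<in> carrier R. r \<otimes> a \<in> I n}" for n
      have "\<exists>N. \<forall>n\<ge>N. A n = A N"
      proof (rule step.IH)
        show "ideal (adjoin J a) R" using adjoin_ideal[OF J.is_ideal ab(1)] by blast
        show "J \<subset> adjoin J a" using adjoin_ideal[OF J.is_ideal ab(1)] ab by blast
        show "Q = P" if "primeideal Q R" "adjoin J a \<subseteq> Q" "Q \<subseteq> P" for Q
          using that step.prems(1) adjoin_ideal(2)[OF J.is_ideal ab(1)] by blast
        show "saturated R P (A n)" for n
          unfolding A_def by (intro P.saturation_saturated adjoin_ideal idI ab)
        show "adjoin J a \<subseteq> A n" for n
        proof -
          have "adjoin J a \<subseteq> adjoin (I n) a" by (rule adjoin_mono[OF JI])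
          then show ?thesis unfolding A_def
            using P.saturation_saturated(2)[OF adjoin_ideal(1)[OF idI ab(1)], of n] by blast
        qed
        show "decseq A" unfolding A_def decseq_def
          by (intro allI impI saturation_mono adjoin_mono decI)
      qed
      then obtain N1 where N1: "\<And>n. n \<ge> N1 \<Longrightarrow> A n = A N1" by blast
      have "\<exists>N. \<forall>n\<ge>N. C n = C N"
      proof (rule step.IH)
        let ?J = "{r \<in> carrier R. r \<otimes> a \<in> J}"
        show "ideal ?J R" by (rule ideal_colon[OF J.is_ideal ab(1)])
        have "J \<subseteq> ?J" using J.I_r_closed ab(1) J.Icarr by blast
        moreover have "b \<in> ?J" using ab m_comm by simp
        ultimately show sub: "J \<subset> ?J" using ab by blast
        show "Q = P" if "primeideal Q R" "?J \<subseteq> Q" "Q \<subseteq> P" for Q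
          using that step.prems(1)[of Q] sub by blast
        show "?J \<subseteq> C n" for n unfolding C_def using JI by blast
        show "decseq C" unfolding C_def decseq_def using decI by blast
        show "saturated R P (C n)" for n
          unfolding saturated_def C_def
        proof (intro conjI ballI impI)
          show "ideal {r \<in> carrier R. r \<otimes> a \<in> I n} R" by (rule ideal_colon[OF idI ab(1)])
          fix s r assume *: "s \<in> carrier R - P" "r \<in> carrier R" "s \<otimes> r \<in> {r \<in> carrier R. r \<otimes> a \<in> I n}"
          then have "s \<otimes> (r \<otimes> a) \<in> I n" using ab by (simp add: m_assoc)
          then show "r \<in> {r \<in> carrier R. r \<otimes> a \<in> I n}"
            using saturatedD(2)[OF sat, of s "r \<otimes> a" n] * ab by simp
        qed
      qed
      then obtain N2 where N2: "\<And>n. n \<ge> N2 \<Longrightarrow> C n = C N2" by blast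
      define N where "N = max N1 N2"
      have "I N \<subseteq> I n" if n: "n \<ge> N" for n
      proof
        fix r assume r: "r \<in> I N"
        interpret IN: ideal "I N" R by (rule idI)
        interpret In: ideal "I n" R by (rule idI)
        have "I N \<subseteq> A N" unfolding A_def
          using P.saturation_saturated(2)[OF adjoin_ideal(1)[OF idI ab(1)]] adjoin_ideal(2)[OF idI ab(1)] by blast
        then have "r \<in> A n" using r N1[of n] N1[of N] n by (auto simp: N_def)
        then obtain s i c where s: "s \<in> carrier R - P" "i \<in> I n" "c \<in> carrier R" "s \<otimes> r = i \<oplus> c \<otimes> a"
          and rc: "r \<in> carrier R"
          unfolding A_def saturation_def mem_adjoin_iff by blast
        have ic: "i \<in> carrier R" using s(2) by simp
        \<comment> \<open>The modular law: \<open>c a\<close> lies in \<open>I N\<close>, so \<open>c\<close> lies in \<open>(I N : a) = (I n : a)\<close>.\<close>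
        have "c \<otimes> a = s \<otimes> r \<oplus> \<ominus> i" unfolding s(4) using s ic ab by algebra
        moreover have "i \<in> I N" using s(2) decI[OF n] by blast
        ultimately have "c \<otimes> a \<in> I N"
          using r s(1) IN.I_l_closed[of r s] IN.a_inv_closed[of i] IN.a_closed by simp
        then have "c \<in> C n" using s(3) N2[of n] N2[of N] n by (auto simp: N_def C_def)
        then have "s \<otimes> r \<in> I n" unfolding s(4) using s(2) by (simp add: C_def In.a_closed)
        then show "r \<in> I n" using saturatedD(2)[OF sat, of s r n] s(1) rc by simp
      qed
      then show ?thesis using decI by blast
    qed
  qed
qed


section \<open>The principal ideal theorem\<close>

text \<open>Nakayama's lemma for the \<open>R\<^sub>P\<close>-module \<open>K R\<^sub>P\<close> and an element \<open>x\<close> of the maximal ideal: if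
\<open>K = L + x K\<close> locally at \<open>P\<close>, then \<open>K = L\<close>. Noetherian induction on \<open>L\<close>, for a fixed \<open>K\<close>: a
saturated ideal inside \<open>K\<close> and strictly above \<open>L\<close> equals \<open>K\<close>. If \<open>x m \<notin> L\<close> for some \<open>m \<in> K\<close>, this applies to the
saturation of \<open>L + (x m)\<close>, so \<open>s m \<in> L + (x m)\<close> with \<open>s \<notin> P\<close>; then \<open>(s - t x) m \<in> L\<close> for some \<open>t\<close>, and \<open>m \<in> L\<close>
because \<open>s - t x \<notin> P\<close>. Hence \<open>x K \<subseteq> L\<close>, and so \<open>K \<subseteq> L\<close>.\<close>

lemma (in noetherian_cring) saturated_Nakayama:
  assumes "primeideal P R" "saturated R P K" "saturated R P L" "L \<subseteq> K" "x \<in> P"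
    and K: "\<And>r. r \<in> K \<Longrightarrow> \<exists>s\<in>carrier R - P. \<exists>l\<in>L. \<exists>k\<in>K. s \<otimes> r = l \<oplus> x \<otimes> k"
  shows "L = K"
proof -
  interpret P: primeideal P R by fact
  interpret K: ideal K R using assms(2) by (rule saturatedD)
  have xc: "x \<in> carrier R" using \<open>x \<in> P\<close> by simp
  have "saturated R P L \<longrightarrow> L \<subseteq> K \<longrightarrow>
      (\<forall>r\<in>K. \<exists>s\<in>carrier R - P. \<exists>l\<in>L. \<exists>k\<in>K. s \<otimes> r = l \<oplus> x \<otimes> k) \<longrightarrow> L = K"
    using saturatedD(1)[OF assms(3)]
  proof (induction L rule: noetherian_induct)
    case (step L)
    interpret L: ideal L R by fact
    show ?case
    proof (intro impI)
      assume satL: "saturated R P L" and LK: "L \<subseteq> K"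
        and gen: "\<forall>r\<in>K. \<exists>s\<in>carrier R - P. \<exists>l\<in>L. \<exists>k\<in>K. s \<otimes> r = l \<oplus> x \<otimes> k"
      have xm: "x \<otimes> m \<in> L" if m: "m \<in> K" for m
      proof (rule ccontr)
        assume nL: "x \<otimes> m \<notin> L"
        have mc: "m \<in> carrier R" using m by simp
        let ?L' = "saturation R P (adjoin L (x \<otimes> m))"
        have xmc: "x \<otimes> m \<in> carrier R" using xc mc by simp
        note L' = P.saturation_saturated[OF adjoin_ideal(1)[OF L.is_ideal xmc]]
        have sub: "L \<subset> ?L'" using L'(2) adjoin_ideal[OF L.is_ideal xmc] nL by blast
        have "adjoin L (x \<otimes> m) \<subseteq> K"
        proof
          fix r assume "r \<in> adjoin L (x \<otimes> m)"
          then obtain l c where "l \<in> L" "c \<in> carrier R" "r = l \<oplus> c \<otimes> (x \<otimes> m)"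
            unfolding mem_adjoin_iff by blast
          then show "r \<in> K" using LK K.I_l_closed m xc by (auto intro!: K.a_closed)
        qed
        then have "?L' \<subseteq> K" by (rule saturation_least[OF assms(2)])
        then have "?L' = K"
          using step.IH[OF saturatedD(1)[OF L'(1)] sub] L'(1) gen sub by blast
        then have "m \<in> ?L'" using m by blast
        then obtain s l t where s: "s \<in> carrier R - P" "l \<in> L" "t \<in> carrier R"
          "s \<otimes> m = l \<oplus> t \<otimes> (x \<otimes> m)"
          unfolding saturation_def mem_adjoin_iff by blast
        have lc: "l \<in> carrier R" and sc: "s \<in> carrier R" using s(1,2) by simp_all
        have "(s \<ominus> t \<otimes> x) \<otimes> m = s \<otimes> m \<ominus> t \<otimes> (x \<otimes> m)" using sc s(3) xc mc by algebra
        also have "\<dots> = l" unfolding s(4) using lc s(3) xc mc by algebra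
        finally have "(s \<ominus> t \<otimes> x) \<otimes> m \<in> L" using s by simp
        moreover have "s \<ominus> t \<otimes> x \<notin> P"
        proof
          assume "s \<ominus> t \<otimes> x \<in> P"
          then have "(s \<ominus> t \<otimes> x) \<oplus> t \<otimes> x \<in> P" using P.I_l_closed[OF \<open>x \<in> P\<close> s(3)] by (rule P.a_closed)
          moreover have "(s \<ominus> t \<otimes> x) \<oplus> t \<otimes> x = s" using sc s(3) xc by algebra
          ultimately show False using s(1) by simp
        qed
        ultimately have "m \<in> L"
          using saturatedD(2)[OF satL, of "s \<ominus> t \<otimes> x" m] s xc mc by simp
        then show False using nL L.I_l_closed xc by blast
      qed
      have "K \<subseteq> L"
      proof
        fix r assume r: "r \<in> K"
        then obtain s l k where s: "s \<in> carrier R - P" "l \<in> L" "k \<in> K" "s \<otimes> r = l \<oplus> x \<otimes> k"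
          using gen by blast
        then have "s \<otimes> r \<in> L" using xm[of k] L.a_closed by simp
        then show "r \<in> L" using saturatedD(2)[OF satL, of s r] s r by simp
      qed
      then show "L = K" using LK by blast
    qed
  qed
  then show ?thesis using assms by blast
qed

text \<open>Krull's principal ideal theorem in the form that lets one modify chains: if there is no such \<open>P'\<close>,
then \<open>x \<notin> Q\<close> and \<open>P\<close> is minimal over \<open>Q0 + (x)\<close>. Choose \<open>y \<in> Q - Q0\<close>, and let \<open>K n\<close> be the preimage of
\<open>(Q0 + (y ^ n)) R\<^sub>Q\<close>; powers of a single element suffice where the classical proof takes symbolic powers of
\<open>Q\<close>. As \<open>R\<^sub>P / (Q0 + (x)) R\<^sub>P\<close> is Artinian, \<open>K n + (x) = K (n + 1) + (x)\<close> locally at \<open>P\<close> for some \<open>n\<close>. Since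
\<open>x \<notin> Q\<close>, an element of \<open>K n\<close> divisible by \<open>x\<close> has its cofactor in \<open>K n\<close>, so \<open>K n = K (n + 1) + x K n\<close>, and
\<open>K n = K (n + 1)\<close> by Nakayama. Thus \<open>s y ^ n \<equiv> t y ^ (n + 1)\<close> modulo \<open>Q0\<close> for some \<open>s \<notin> Q\<close>. Cancelling
\<open>y ^ n\<close> in the domain \<open>R / Q0\<close> gives \<open>s \<equiv> t y\<close>, which puts \<open>s\<close> into \<open>Q\<close>.\<close>

lemma (in noetherian_cring) exists_prime_between:
  assumes primes: "primeideal Q0 R" "primeideal Q R" "primeideal P R"
    and sub: "Q0 \<subset> Q" "Q \<subset> P" and x: "x \<in> P"
  shows "\<exists>P'. primeideal P' R \<and> Q0 \<subset> P' \<and> P' \<subset> P \<and> x \<in> P'"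
proof (rule ccontr)
  assume none: "\<nexists>P'. primeideal P' R \<and> Q0 \<subset> P' \<and> P' \<subset> P \<and> x \<in> P'"
  interpret Q0: primeideal Q0 R by fact
  interpret Q: primeideal Q R by fact
  interpret P: primeideal P R by fact
  have xQ: "x \<notin> Q" using none primes sub by blast
  have xc: "x \<in> carrier R" using x by simp
  obtain y where y: "y \<in> Q" "y \<notin> Q0" using sub by blast
  then have yc: "y \<in> carrier R" by simp
  define K where "K n = saturation R Q (adjoin Q0 (y [^] (n::nat)))" for n
  \<comment> \<open>The \<open>K n\<close> are saturated even with respect to the smaller prime \<open>Q\<close>; this is what divides by \<open>x\<close> below.\<close>
  have satK: "saturated R Q (K n)" for n
    unfolding K_def by (intro Q.saturation_saturated adjoin_ideal Q0.is_ideal nat_pow_closed yc)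
  have idK: "ideal (K n) R" for n using satK by (rule saturatedD)
  have Q0K: "Q0 \<subseteq> K n" for n
    using Q.saturation_saturated(2) adjoin_ideal[OF Q0.is_ideal nat_pow_closed[OF yc]]
    unfolding K_def by blast
  have powK: "y [^] n \<in> K n" for n
    using Q.saturation_saturated(2) adjoin_ideal[OF Q0.is_ideal nat_pow_closed[OF yc]]
    unfolding K_def by blast
  have decK: "decseq K"
  proof (rule decseq_SucI)
    fix n
    have "adjoin Q0 (y [^] Suc n) \<subseteq> adjoin Q0 (y [^] n)"
    proof
      fix r assume "r \<in> adjoin Q0 (y [^] Suc n)"
      then obtain q c where q: "q \<in> Q0" "c \<in> carrier R" "r = q \<oplus> c \<otimes> y [^] Suc n"
        unfolding mem_adjoin_iff by blast
      then have "r = q \<oplus> (c \<otimes> y) \<otimes> y [^] n" using yc by (simp add: m_ac)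
      then show "r \<in> adjoin Q0 (y [^] n)" unfolding mem_adjoin_iff using q yc by blast
    qed
    then show "K (Suc n) \<subseteq> K n" unfolding K_def by (rule saturation_mono)
  qed
  define I where "I n = saturation R P (adjoin (K n) x)" for n
  have "\<exists>N. \<forall>n\<ge>N. I n = I N"
  proof (rule saturated_dcc)
    show "ideal (adjoin Q0 x) R" "primeideal P R" using adjoin_ideal[OF Q0.is_ideal xc] primes by auto
    show "P' = P" if "primeideal P' R" "adjoin Q0 x \<subseteq> P'" "P' \<subseteq> P" for P'
    proof -
      have "x \<in> P'" "Q0 \<subset> P'" using that adjoin_ideal[OF Q0.is_ideal xc] xQ sub by blast+
      then show ?thesis using none that by blast
    qed
    show "saturated R P (I n)" for n
      unfolding I_def by (intro P.saturation_saturated adjoin_ideal idK xc)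
    show "adjoin Q0 x \<subseteq> I n" for n
    proof -
      have "adjoin Q0 x \<subseteq> adjoin (K n) x" by (rule adjoin_mono[OF Q0K])
      then show ?thesis unfolding I_def
        using P.saturation_saturated(2)[OF adjoin_ideal(1)[OF idK xc]] by blast
    qed
    show "decseq I" unfolding I_def decseq_def
      by (intro allI impI saturation_mono adjoin_mono decseqD[OF decK])
  qed
  then obtain n where n: "I (Suc n) = I n" by (metis le_Suc_eq order_refl)
  have "K (Suc n) = K n"
  proof (rule saturated_Nakayama[OF primes(3) _ _ _ x])
    show "saturated R P (K n)" "saturated R P (K (Suc n))"
      using saturated_antimono[OF satK] sub by auto
    show KK: "K (Suc n) \<subseteq> K n" using decK by (simp add: decseq_Suc_iff)
    fix r assume r: "r \<in> K n"
    interpret K: ideal "K n" R by (rule idK)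
    have "r \<in> I n" unfolding I_def
      using r P.saturation_saturated(2)[OF adjoin_ideal(1)[OF idK xc]] adjoin_ideal(2)[OF idK xc] by blast
    then have "r \<in> I (Suc n)" using n by simp
    then obtain s k c where s: "s \<in> carrier R - P" "k \<in> K (Suc n)" "c \<in> carrier R" "s \<otimes> r = k \<oplus> c \<otimes> x"
      unfolding I_def saturation_def mem_adjoin_iff by blast
    have kK: "k \<in> K n" using s KK by blast
    then have kc: "k \<in> carrier R" by simp
    have "x \<otimes> c = s \<otimes> r \<oplus> \<ominus> k" unfolding s(4) using kc s xc by algebra
    then have "x \<otimes> c \<in> K n" using r s kK K.I_l_closed[of r s] by (simp add: K.a_closed)
    then have "c \<in> K n" using saturatedD(2)[OF satK, of x c n] xc xQ s(3) by simp
    moreover have "s \<otimes> r = k \<oplus> x \<otimes> c" using s xc m_comm by simp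
    ultimately show "\<exists>s\<in>carrier R - P. \<exists>l\<in>K (Suc n). \<exists>k\<in>K n. s \<otimes> r = l \<oplus> x \<otimes> k"
      using s by blast
  qed
  then have "y [^] n \<in> K (Suc n)" using powK by blast
  then obtain s q t where s: "s \<in> carrier R - Q" "q \<in> Q0" "t \<in> carrier R"
    "s \<otimes> y [^] n = q \<oplus> t \<otimes> y [^] Suc n"
    unfolding K_def saturation_def mem_adjoin_iff by blast
  have qc: "q \<in> carrier R" and sc: "s \<in> carrier R" using s(1,2) by simp_all
  have ync: "y [^] n \<in> carrier R" using yc by simp
  have yn: "y [^] n \<notin> Q0"
  proof (induction n)
    case 0
    then show ?case using Q0.one_notin by simp
  next
    case (Suc n)
    then show ?case using Q0.I_prime[OF nat_pow_closed[OF yc, of n] yc] y(2) by auto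
  qed
  have "(s \<ominus> t \<otimes> y) \<otimes> y [^] n = s \<otimes> y [^] n \<ominus> t \<otimes> (y [^] n \<otimes> y)" using sc s(3) yc ync by algebra
  also have "\<dots> = s \<otimes> y [^] n \<ominus> t \<otimes> y [^] Suc n" by simp
  also have "\<dots> = q" unfolding s(4) using s(3) qc nat_pow_closed[OF yc, of "Suc n"] by algebra
  finally have "(s \<ominus> t \<otimes> y) \<otimes> y [^] n \<in> Q0" using s by simp
  then have "s \<ominus> t \<otimes> y \<in> Q0" using Q0.I_prime[of "s \<ominus> t \<otimes> y" "y [^] n"] yn s yc by simp
  then have "s \<ominus> t \<otimes> y \<in> Q" using sub by blast
  then have "(s \<ominus> t \<otimes> y) \<oplus> t \<otimes> y \<in> Q" using Q.I_l_closed[OF y(1) s(3)] by (rule Q.a_closed)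
  moreover have "(s \<ominus> t \<otimes> y) \<oplus> t \<otimes> y = s" using sc s(3) yc by algebra
  ultimately show False using s(1) by simp
qed

section \<open>Chains of primes have bounded length\<close>

text \<open>A strictly descending chain of \<open>n + 1\<close> primes from \<open>P\<close> down to a prime containing \<open>A\<close>; so all its
members contain \<open>A\<close>.\<close>

primrec prime_chain :: "('a, 'r) ring_scheme \<Rightarrow> 'a set \<Rightarrow> 'a set \<Rightarrow> nat \<Rightarrow> bool" where
  "prime_chain R A P 0 \<longleftrightarrow> primeideal P R \<and> A \<subseteq> P"
| "prime_chain R A P (Suc n) \<longleftrightarrow> primeideal P R \<and> (\<exists>Q. Q \<subset> P \<and> prime_chain R A Q n)"

lemma prime_chainD: "prime_chain R A P n \<Longrightarrow> primeideal P R \<and> A \<subseteq> P"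
  by (induction n arbitrary: P) auto

context noetherian_cring
begin

text \<open>One generator costs one step: the primes of the chain can be exchanged, from the top downwards, for
primes that contain \<open>x\<close>; the last one is lost.\<close>

lemma prime_chain_insert:
  assumes "prime_chain R A P (Suc n)" "x \<in> P"
  shows "prime_chain R (insert x A) P n"
  using assms
proof (induction n arbitrary: P)
  case 0
  then show ?case using prime_chainD[OF 0(1)] by simp
next
  case (Suc n)
  then obtain P1 P2 where P: "primeideal P R" "P1 \<subset> P" "primeideal P1 R" "P2 \<subset> P1" "prime_chain R A P2 n"
    by auto
  then obtain P' where P': "primeideal P' R" "P2 \<subset> P'" "P' \<subset> P" "x \<in> P'"
    using exists_prime_between[of P2 P1 P x] prime_chainD[OF P(5)] Suc.prems by blast
  then have "prime_chain R A P' (Suc n)" using P unfolding prime_chain.simps by blast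
  from Suc.IH[OF this P'(4)] show ?case using P' P unfolding prime_chain.simps by blast
qed

lemma prime_chain_union:
  assumes "finite X" "X \<subseteq> P" "prime_chain R A P (card X + n)"
  shows "prime_chain R (X \<union> A) P n"
  using assms
proof (induction X arbitrary: A rule: finite_induct)
  case empty
  then show ?case by simp
next
  case (insert x X)
  then have "prime_chain R (insert x A) P (card X + n)"
    by (intro prime_chain_insert) auto
  then have "prime_chain R (X \<union> insert x A) P n" using insert by blast
  then show ?case by simp
qed

text \<open>If \<open>P\<close> is generated by a finite set \<open>X\<close>, then a chain with more than \<open>card X\<close> steps could be
exchanged for one with a step to a prime strictly below \<open>P\<close> that still contains \<open>X\<close>.\<close>

lemma prime_chain_bounded:
  assumes "primeideal P R"
  shows "\<exists>n. \<not> prime_chain R {} P n"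
proof -
  interpret P: primeideal P R by fact
  obtain X where X: "X \<subseteq> carrier R" "finite X" "P = Idl X"
    using finetely_gen[OF P.is_ideal] by blast
  have "X \<subseteq> P" using X genideal_self by blast
  have "\<not> prime_chain R {} P (card X + 1)"
  proof
    assume "prime_chain R {} P (card X + 1)"
    then have "prime_chain R X P 1" using prime_chain_union[OF X(2) \<open>X \<subseteq> P\<close>, of "{}" 1] by simp
    then obtain Q where Q: "Q \<subset> P" "primeideal Q R" "X \<subseteq> Q" by auto
    then have "P \<subseteq> Q" using X(3) genideal_minimal[of Q X] primeideal.axioms(1) by blast
    with Q show False by blast
  qed
  then show ?thesis by blast
qed

text \<open>Otherwise every member of \<open>C\<close> below \<open>P\<close> has a smaller one, which gives arbitrarily long chains
below \<open>P\<close>.\<close>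

lemma exists_minimal_prime_below:
  assumes C: "C \<subseteq> Spec R" and P: "P \<in> C"
  shows "\<exists>Q\<in>minimal_primes C. Q \<subseteq> P"
proof (rule ccontr)
  assume no: "\<not> (\<exists>Q\<in>minimal_primes C. Q \<subseteq> P)"
  have "prime_chain R {} Q n" if "Q \<in> C" "Q \<subseteq> P" for Q n
    using that
  proof (induction n arbitrary: Q)
    case 0
    then show ?case using C by (auto simp: Spec_def)
  next
    case (Suc n)
    then have "Q \<notin> minimal_primes C" using no by blast
    then obtain Q' where Q': "Q' \<in> C" "Q' \<subset> Q" using Suc.prems by (auto simp: minimal_primes_def)
    then have "prime_chain R {} Q' n" using Suc.IH Suc.prems by blast
    moreover have "primeideal Q R" using Suc.prems C by (auto simp: Spec_def)
    ultimately show ?case using Q' unfolding prime_chain.simps by blast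
  qed
  then show False using prime_chain_bounded[of P] C P by (auto simp: Spec_def)
qed

end


section \<open>Minimal primes and closed sets\<close>

context noetherian_cring
begin

text \<open>Noetherian induction: if \<open>I\<close> is proper and not prime, with \<open>a b \<in> I\<close> and \<open>a\<close>, \<open>b\<close> outside \<open>I\<close>, then
every prime over \<open>I\<close> lies over \<open>I + (a)\<close> or \<open>I + (b)\<close>.\<close>

lemma finite_minimal_primes:
  assumes "ideal I R"
  shows "finite (minimal_primes (zariski_V R I))"
  using assms
proof (induction I rule: noetherian_induct)
  case (step I)
  interpret I: ideal I R by fact
  consider "I = carrier R" | "primeideal I R" | "I \<noteq> carrier R" "\<not> primeideal I R" by blast
  then show ?case
  proof cases
    case 1
    have "zariski_V R I = {}"
      unfolding zariski_V_def Spec_def 1 using primeideal.one_notin by auto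
    then show ?thesis by (simp add: minimal_primes_def)
  next
    case 2
    then have "minimal_primes (zariski_V R I) \<subseteq> {I}"
      by (auto simp: minimal_primes_def zariski_V_def Spec_def)
    then show ?thesis by (rule finite_subset) simp
  next
    case 3
    then obtain a b where ab: "a \<in> carrier R" "b \<in> carrier R" "a \<otimes> b \<in> I" "a \<notin> I" "b \<notin> I"
      using I.primeidealCD[OF is_cring] by blast
    have fin: "finite (minimal_primes (zariski_V R (adjoin I c)))" if "c \<in> {a, b}" for c
    proof (rule step.IH)
      have c: "c \<in> carrier R" "c \<notin> I" using that ab by auto
      show "ideal (adjoin I c) R" "I \<subset> adjoin I c"
        using adjoin_ideal[OF I.is_ideal c(1)] c by auto
    qed
    have V: "P \<in> zariski_V R (adjoin I c) \<longleftrightarrow> P \<in> zariski_V R I \<and> c \<in> P" if "c \<in> {a, b}" for P c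
    proof
      have c: "c \<in> carrier R" using that ab by auto
      show "P \<in> zariski_V R I \<and> c \<in> P" if "P \<in> zariski_V R (adjoin I c)"
        using that adjoin_ideal[OF I.is_ideal c] by (auto simp: zariski_V_def)
      assume P: "P \<in> zariski_V R I \<and> c \<in> P"
      then interpret P: primeideal P R by (auto simp: zariski_V_def Spec_def)
      have "adjoin I c \<subseteq> P"
      proof
        fix r assume "r \<in> adjoin I c"
        then obtain i d where "i \<in> I" "d \<in> carrier R" "r = i \<oplus> d \<otimes> c"
          unfolding mem_adjoin_iff by blast
        then show "r \<in> P" using P P.I_l_closed by (auto simp: zariski_V_def intro!: P.a_closed)
      qed
      then show "P \<in> zariski_V R (adjoin I c)" using P by (auto simp: zariski_V_def)
    qed
    have sub: "minimal_primes (zariski_V R I) \<subseteq>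
      minimal_primes (zariski_V R (adjoin I a)) \<union> minimal_primes (zariski_V R (adjoin I b))"
    proof
      fix P assume P: "P \<in> minimal_primes (zariski_V R I)"
      then have PV: "P \<in> zariski_V R I" by (simp add: minimal_primes_def)
      then interpret P: primeideal P R by (auto simp: zariski_V_def Spec_def)
      have "a \<otimes> b \<in> P" using ab PV by (auto simp: zariski_V_def)
      then have "a \<in> P \<or> b \<in> P" using P.I_prime ab by blast
      moreover have "P \<in> minimal_primes (zariski_V R (adjoin I c))" if "c \<in> {a, b}" "c \<in> P" for c
        using P that(2) V[OF that(1)] unfolding minimal_primes_def by simp
      ultimately show "P \<in> minimal_primes (zariski_V R (adjoin I a)) \<union> minimal_primes (zariski_V R (adjoin I b))"
        by blast
    qed
    show ?thesis by (rule finite_subset[OF sub finite_UnI]) (rule fin, simp)+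
  qed
qed

text \<open>As every member of \<open>C\<close> contains a minimal one, a specialization-closed \<open>C\<close> is the union of the closed
sets \<open>V(P)\<close> over its minimal elements \<open>P\<close>.\<close>

lemma finite_minimal_primes_iff_closedin:
  assumes C: "C \<subseteq> Spec R"
    and up: "\<And>P Q. P \<in> C \<Longrightarrow> Q \<in> Spec R \<Longrightarrow> P \<subseteq> Q \<Longrightarrow> Q \<in> C"
  shows "finite (minimal_primes C) \<longleftrightarrow> closedin (zariski R) C"
proof
  assume "closedin (zariski R) C"
  then obtain I where "ideal I R" "C = zariski_V R I" unfolding closedin_zariski by blast
  then show "finite (minimal_primes C)" using finite_minimal_primes by simp
next
  assume fin: "finite (minimal_primes C)"
  have "closedin (zariski R) (zariski_V R P)" if "P \<in> minimal_primes C" for P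
  proof -
    have "ideal P R" using that C by (auto simp: minimal_primes_def Spec_def primeideal_def)
    then show ?thesis unfolding closedin_zariski by blast
  qed
  then have "closedin (zariski R) (\<Union>P\<in>minimal_primes C. zariski_V R P)"
    using fin by (intro closedin_Union) auto
  moreover have "(\<Union>P\<in>minimal_primes C. zariski_V R P) = C"
  proof
    show "(\<Union>P\<in>minimal_primes C. zariski_V R P) \<subseteq> C"
      using up by (auto simp: minimal_primes_def zariski_V_def)
    show "C \<subseteq> (\<Union>P\<in>minimal_primes C. zariski_V R P)"
      using exists_minimal_prime_below[OF C] C by (fastforce simp: zariski_V_def)
  qed
  ultimately show "closedin (zariski R) C" by simp
qed

end


section \<open>Localization of rings and modules\<close>

locale mult_set = cring R for R (structure) +
  fixes S :: "'a set"
  assumes S_carrier: "S \<subseteq> carrier R"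
    and one_S: "\<one> \<in> S"
    and mult_S: "s \<in> S \<Longrightarrow> t \<in> S \<Longrightarrow> s \<otimes> t \<in> S"

text \<open>Fractions are treated for modules first, because the additive group of the ring of fractions of
\<open>R\<close>, and its multiplication, are those of the fractions of \<open>R\<close> as a module over itself.\<close>

locale fraction_module = mult_set R S + module R M for R (structure) and S and M (structure)
begin

abbreviation "fr \<equiv> fraction S M"

lemma S_closed [simp]: "s \<in> S \<Longrightarrow> s \<in> carrier R"
  using S_carrier by blast

lemmas smult_collect = smult_assoc1[symmetric] m_ac

lemma frac_eq_iff:
  assumes x: "x \<in> carrier M" "s \<in> S" and y: "y \<in> carrier M" "t \<in> S"
  shows "fr x s = fr y t \<longleftrightarrow> (\<exists>u\<in>S. u \<odot>\<^bsub>M\<^esub> (t \<odot>\<^bsub>M\<^esub> x) = u \<odot>\<^bsub>M\<^esub> (s \<odot>\<^bsub>M\<^esub> y))"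
proof
  assume eq: "fr x s = fr y t"
  have "(y, t) \<in> fr y t" using y one_S by (auto simp: fraction_def)
  then show "\<exists>u\<in>S. u \<odot>\<^bsub>M\<^esub> (t \<odot>\<^bsub>M\<^esub> x) = u \<odot>\<^bsub>M\<^esub> (s \<odot>\<^bsub>M\<^esub> y)"
    unfolding eq[symmetric] by (simp add: fraction_def)
next
  have sub: "fr y t \<subseteq> fr x s"
    if x: "x \<in> carrier M" "s \<in> S" and y: "y \<in> carrier M" "t \<in> S"
      and u: "u \<in> S" "u \<odot>\<^bsub>M\<^esub> (t \<odot>\<^bsub>M\<^esub> x) = u \<odot>\<^bsub>M\<^esub> (s \<odot>\<^bsub>M\<^esub> y)" for x s y t u
  proof
    fix p assume "p \<in> fr y t"
    then obtain z r v where z: "p = (z, r)" "z \<in> carrier M" "r \<in> S" "v \<in> S"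
      "v \<odot>\<^bsub>M\<^esub> (r \<odot>\<^bsub>M\<^esub> y) = v \<odot>\<^bsub>M\<^esub> (t \<odot>\<^bsub>M\<^esub> z)"
      unfolding fraction_def by blast
    \<comment> \<open>Transitivity of the relation; the factor \<open>t\<close> is needed to eliminate the middle fraction \<open>y / t\<close>.\<close>
    have "(u \<otimes> v \<otimes> t) \<odot>\<^bsub>M\<^esub> (r \<odot>\<^bsub>M\<^esub> x) = (v \<otimes> r) \<odot>\<^bsub>M\<^esub> (u \<odot>\<^bsub>M\<^esub> (t \<odot>\<^bsub>M\<^esub> x))"
      using x y z u(1) by (simp add: smult_collect)
    also have "\<dots> = (u \<otimes> s) \<odot>\<^bsub>M\<^esub> (v \<odot>\<^bsub>M\<^esub> (r \<odot>\<^bsub>M\<^esub> y))"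
      unfolding u(2) using x y z(1-4) u(1) by (simp add: smult_collect)
    also have "\<dots> = (u \<otimes> v \<otimes> t) \<odot>\<^bsub>M\<^esub> (s \<odot>\<^bsub>M\<^esub> z)"
      unfolding z(5) using x y z(1-4) u(1) by (simp add: smult_collect)
    finally show "p \<in> fr x s"
      unfolding fraction_def using x y z u mult_S by blast
  qed
  assume "\<exists>u\<in>S. u \<odot>\<^bsub>M\<^esub> (t \<odot>\<^bsub>M\<^esub> x) = u \<odot>\<^bsub>M\<^esub> (s \<odot>\<^bsub>M\<^esub> y)"
  then obtain u where u: "u \<in> S" "u \<odot>\<^bsub>M\<^esub> (t \<odot>\<^bsub>M\<^esub> x) = u \<odot>\<^bsub>M\<^esub> (s \<odot>\<^bsub>M\<^esub> y)" by blast
  show "fr x s = fr y t" using sub[OF x y u] sub[OF y x u(1) u(2)[symmetric]] by blast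
qed

lemma frac_eqI:
  assumes "x \<in> carrier M" "s \<in> S" "y \<in> carrier M" "t \<in> S" "t \<odot>\<^bsub>M\<^esub> x = s \<odot>\<^bsub>M\<^esub> y"
  shows "fr x s = fr y t"
  using assms one_S by (auto simp: frac_eq_iff)

lemma frac_self: "x \<in> carrier M \<Longrightarrow> s \<in> S \<Longrightarrow> (x, s) \<in> fr x s"
  using one_S by (auto simp: fraction_def)

lemma mem_frac:
  assumes "x \<in> carrier M" "s \<in> S" "(y, t) \<in> fr x s"
  obtains u where "y \<in> carrier M" "t \<in> S" "u \<in> S" "u \<odot>\<^bsub>M\<^esub> (t \<odot>\<^bsub>M\<^esub> x) = u \<odot>\<^bsub>M\<^esub> (s \<odot>\<^bsub>M\<^esub> y)"
  using assms(3) unfolding fraction_def by blast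

end

text \<open>Operations on fractions are unions over representatives; this evaluates them once independence of the
representatives is known.\<close>

lemma UN_eq_const:
  assumes "A \<noteq> {}" "B \<noteq> {}" "\<And>x s y t. (x, s) \<in> A \<Longrightarrow> (y, t) \<in> B \<Longrightarrow> f x s y t = c"
  shows "(\<Union>(x, s)\<in>A. \<Union>(y, t)\<in>B. f x s y t) = c"
proof -
  have "(\<Union>(x, s)\<in>A. \<Union>(y, t)\<in>B. f x s y t) = (\<Union>p\<in>A. \<Union>q\<in>B. c)"
    using assms(3) by (intro SUP_cong) (auto simp only: split: prod.splits)
  then show ?thesis using assms(1,2) by simp
qed

lemma regular_module_simps:
  "carrier (regular_module R) = carrier R" "add (regular_module R) = add R"
  "ring.zero (regular_module R) = \<zero>\<^bsub>R\<^esub>" "smult (regular_module R) = monoid.mult R"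
  by (simp_all add: regular_module_def)

sublocale mult_set \<subseteq> reg: fraction_module R S "regular_module R"
  by (intro fraction_module.intro mult_set_axioms regular_module)

context fraction_module
begin

abbreviation "LM \<equiv> loc_module R S M"

lemma loc_module_carrierE:
  assumes "X \<in> carrier LM"
  obtains x s where "x \<in> carrier M" "s \<in> S" "X = fr x s"
  using assms by (auto simp: loc_module_def)

lemma frac_closed [simp]: "x \<in> carrier M \<Longrightarrow> s \<in> S \<Longrightarrow> fr x s \<in> carrier LM"
  by (auto simp: loc_module_def)

lemma loc_module_zero: "\<zero>\<^bsub>LM\<^esub> = fr \<zero>\<^bsub>M\<^esub> \<one>"
  by (simp add: loc_module_def)

lemma frac_add:
  assumes x: "x \<in> carrier M" "s \<in> S" and y: "y \<in> carrier M" "t \<in> S"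
  shows "fr x s \<oplus>\<^bsub>LM\<^esub> fr y t = fr (t \<odot>\<^bsub>M\<^esub> x \<oplus>\<^bsub>M\<^esub> s \<odot>\<^bsub>M\<^esub> y) (s \<otimes> t)"
proof -
  have eq: "fr (t' \<odot>\<^bsub>M\<^esub> x' \<oplus>\<^bsub>M\<^esub> s' \<odot>\<^bsub>M\<^esub> y') (s' \<otimes> t') = fr (t \<odot>\<^bsub>M\<^esub> x \<oplus>\<^bsub>M\<^esub> s \<odot>\<^bsub>M\<^esub> y) (s \<otimes> t)"
    if x': "(x', s') \<in> fr x s" and y': "(y', t') \<in> fr y t" for x' s' y' t'
  proof -
    obtain u where u: "x' \<in> carrier M" "s' \<in> S" "u \<in> S" "u \<odot>\<^bsub>M\<^esub> (s' \<odot>\<^bsub>M\<^esub> x) = u \<odot>\<^bsub>M\<^esub> (s \<odot>\<^bsub>M\<^esub> x')"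
      using mem_frac[OF x x'] by metis
    obtain v where v: "y' \<in> carrier M" "t' \<in> S" "v \<in> S" "v \<odot>\<^bsub>M\<^esub> (t' \<odot>\<^bsub>M\<^esub> y) = v \<odot>\<^bsub>M\<^esub> (t \<odot>\<^bsub>M\<^esub> y')"
      using mem_frac[OF y y'] by metis
    note c = x y u(1-3) v(1-3)
    have "(u \<otimes> v) \<odot>\<^bsub>M\<^esub> ((s' \<otimes> t') \<odot>\<^bsub>M\<^esub> (t \<odot>\<^bsub>M\<^esub> x \<oplus>\<^bsub>M\<^esub> s \<odot>\<^bsub>M\<^esub> y))
      = (v \<otimes> (t \<otimes> t')) \<odot>\<^bsub>M\<^esub> (u \<odot>\<^bsub>M\<^esub> (s' \<odot>\<^bsub>M\<^esub> x)) \<oplus>\<^bsub>M\<^esub> (u \<otimes> (s \<otimes> s')) \<odot>\<^bsub>M\<^esub> (v \<odot>\<^bsub>M\<^esub> (t' \<odot>\<^bsub>M\<^esub> y))"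
      using c by (simp add: smult_r_distr smult_collect)
    also have "\<dots> = (u \<otimes> v) \<odot>\<^bsub>M\<^esub> ((s \<otimes> t) \<odot>\<^bsub>M\<^esub> (t' \<odot>\<^bsub>M\<^esub> x' \<oplus>\<^bsub>M\<^esub> s' \<odot>\<^bsub>M\<^esub> y'))"
      unfolding u(4) v(4) using c by (simp add: smult_r_distr smult_collect)
    finally show ?thesis
      using c mult_S by (subst frac_eq_iff) (auto intro!: bexI[of _ "u \<otimes> v"])
  qed
  have ne: "fr x s \<noteq> {}" "fr y t \<noteq> {}" using frac_self[OF x] frac_self[OF y] by blast+
  have "(\<Union>(x', s')\<in>fr x s. \<Union>(y', t')\<in>fr y t.
      fr (t' \<odot>\<^bsub>M\<^esub> x' \<oplus>\<^bsub>M\<^esub> s' \<odot>\<^bsub>M\<^esub> y') (s' \<otimes> t')) = fr (t \<odot>\<^bsub>M\<^esub> x \<oplus>\<^bsub>M\<^esub> s \<odot>\<^bsub>M\<^esub> y) (s \<otimes> t)"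
    by (rule UN_eq_const[OF ne eq])
  then show ?thesis by (simp add: loc_module_def)
qed

lemma frac_smult:
  assumes a: "a \<in> carrier R" "s \<in> S" and x: "x \<in> carrier M" "t \<in> S"
  shows "reg.fr a s \<odot>\<^bsub>LM\<^esub> fr x t = fr (a \<odot>\<^bsub>M\<^esub> x) (s \<otimes> t)"
proof -
  have eq: "fr (a' \<odot>\<^bsub>M\<^esub> x') (s' \<otimes> t') = fr (a \<odot>\<^bsub>M\<^esub> x) (s \<otimes> t)"
    if a': "(a', s') \<in> reg.fr a s" and x': "(x', t') \<in> fr x t" for a' s' x' t'
  proof -
    obtain u where u: "a' \<in> carrier R" "s' \<in> S" "u \<in> S" "u \<otimes> (s' \<otimes> a) = u \<otimes> (s \<otimes> a')"
      using reg.mem_frac[of a s, unfolded regular_module_simps, OF a a'] by metis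
    obtain v where v: "x' \<in> carrier M" "t' \<in> S" "v \<in> S" "v \<odot>\<^bsub>M\<^esub> (t' \<odot>\<^bsub>M\<^esub> x) = v \<odot>\<^bsub>M\<^esub> (t \<odot>\<^bsub>M\<^esub> x')"
      using mem_frac[OF x x'] by metis
    note c = a x u(1-3) v(1-3)
    have "(u \<otimes> v) \<odot>\<^bsub>M\<^esub> ((s' \<otimes> t') \<odot>\<^bsub>M\<^esub> (a \<odot>\<^bsub>M\<^esub> x)) = (u \<otimes> (s' \<otimes> a)) \<odot>\<^bsub>M\<^esub> (v \<odot>\<^bsub>M\<^esub> (t' \<odot>\<^bsub>M\<^esub> x))"
      using c by (simp add: smult_collect)
    also have "\<dots> = (u \<otimes> v) \<odot>\<^bsub>M\<^esub> ((s \<otimes> t) \<odot>\<^bsub>M\<^esub> (a' \<odot>\<^bsub>M\<^esub> x'))"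
      unfolding u(4) v(4) using c by (simp add: smult_collect)
    finally show ?thesis
      using c mult_S by (subst frac_eq_iff) (auto intro!: bexI[of _ "u \<otimes> v"])
  qed
  have ne: "reg.fr a s \<noteq> {}" "fr x t \<noteq> {}"
    using reg.frac_self[of a s] frac_self[OF x] a unfolding regular_module_simps by blast+
  have "(\<Union>(a', s')\<in>reg.fr a s. \<Union>(x', t')\<in>fr x t.
      fr (a' \<odot>\<^bsub>M\<^esub> x') (s' \<otimes> t')) = fr (a \<odot>\<^bsub>M\<^esub> x) (s \<otimes> t)"
    by (rule UN_eq_const[OF ne eq])
  then show ?thesis by (simp add: loc_module_def)
qed

lemma loc_module_abelian_group: "abelian_group LM"
proof (rule abelian_groupI)
  show "\<zero>\<^bsub>LM\<^esub> \<in> carrier LM" by (simp add: loc_module_zero one_S)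
next
  fix X Y assume "X \<in> carrier LM" "Y \<in> carrier LM"
  then obtain x s y t where X: "x \<in> carrier M" "s \<in> S" "X = fr x s"
    and Y: "y \<in> carrier M" "t \<in> S" "Y = fr y t" by (elim loc_module_carrierE) blast
  then show "X \<oplus>\<^bsub>LM\<^esub> Y \<in> carrier LM" by (simp add: frac_add mult_S)
  show "X \<oplus>\<^bsub>LM\<^esub> Y = Y \<oplus>\<^bsub>LM\<^esub> X" using X Y by (simp add: frac_add M.a_comm m_comm)
next
  fix X Y Z assume "X \<in> carrier LM" "Y \<in> carrier LM" "Z \<in> carrier LM"
  then obtain x s y t z r where "x \<in> carrier M" "s \<in> S" "X = fr x s"
    "y \<in> carrier M" "t \<in> S" "Y = fr y t" "z \<in> carrier M" "r \<in> S" "Z = fr z r"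
    by (elim loc_module_carrierE) blast
  then show "X \<oplus>\<^bsub>LM\<^esub> Y \<oplus>\<^bsub>LM\<^esub> Z = X \<oplus>\<^bsub>LM\<^esub> (Y \<oplus>\<^bsub>LM\<^esub> Z)"
    by (simp add: frac_add mult_S smult_r_distr smult_collect M.a_assoc)
next
  fix X assume "X \<in> carrier LM"
  then obtain x s where X: "x \<in> carrier M" "s \<in> S" "X = fr x s" by (elim loc_module_carrierE)
  then show "\<zero>\<^bsub>LM\<^esub> \<oplus>\<^bsub>LM\<^esub> X = X" by (simp add: loc_module_zero frac_add one_S)
  have "fr (\<ominus>\<^bsub>M\<^esub> x) s \<oplus>\<^bsub>LM\<^esub> X = \<zero>\<^bsub>LM\<^esub>"
    unfolding loc_module_zero X(3) frac_add[OF M.a_inv_closed[OF X(1)] X(2) X(1,2)]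
    by (rule frac_eqI) (use X in \<open>simp_all add: smult_r_minus M.l_neg one_S mult_S\<close>)
  with X show "\<exists>Y\<in>carrier LM. Y \<oplus>\<^bsub>LM\<^esub> X = \<zero>\<^bsub>LM\<^esub>"
    by (intro bexI[of _ "fr (\<ominus>\<^bsub>M\<^esub> x) s"]) auto
qed

text \<open>A fraction \<open>x / s\<close> is zero iff some \<open>u \<in> S\<close> kills \<open>x\<close>.\<close>

lemma loc_module_nonzero_iff:
  "carrier LM \<noteq> {\<zero>\<^bsub>LM\<^esub>} \<longleftrightarrow> (\<exists>x\<in>carrier M. \<forall>u\<in>S. u \<odot>\<^bsub>M\<^esub> x \<noteq> \<zero>\<^bsub>M\<^esub>)"
proof -
  have *: "fr x s = \<zero>\<^bsub>LM\<^esub> \<longleftrightarrow> (\<exists>u\<in>S. u \<odot>\<^bsub>M\<^esub> x = \<zero>\<^bsub>M\<^esub>)" if "x \<in> carrier M" "s \<in> S" for x s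
    using that one_S by (simp add: loc_module_zero frac_eq_iff)
  have "carrier LM \<noteq> {\<zero>\<^bsub>LM\<^esub>} \<longleftrightarrow> (\<exists>X\<in>carrier LM. X \<noteq> \<zero>\<^bsub>LM\<^esub>)"
    using abelian_group.axioms(1)[OF loc_module_abelian_group, THEN abelian_monoid.zero_closed] by blast
  also have "\<dots> \<longleftrightarrow> (\<exists>x\<in>carrier M. \<forall>u\<in>S. u \<odot>\<^bsub>M\<^esub> x \<noteq> \<zero>\<^bsub>M\<^esub>)"
  proof
    assume "\<exists>X\<in>carrier LM. X \<noteq> \<zero>\<^bsub>LM\<^esub>"
    then show "\<exists>x\<in>carrier M. \<forall>u\<in>S. u \<odot>\<^bsub>M\<^esub> x \<noteq> \<zero>\<^bsub>M\<^esub>" using * by (metis loc_module_carrierE)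
  next
    assume "\<exists>x\<in>carrier M. \<forall>u\<in>S. u \<odot>\<^bsub>M\<^esub> x \<noteq> \<zero>\<^bsub>M\<^esub>"
    then show "\<exists>X\<in>carrier LM. X \<noteq> \<zero>\<^bsub>LM\<^esub>" using * one_S frac_closed by metis
  qed
  finally show ?thesis .
qed

end

context mult_set
begin

abbreviation "LR \<equiv> loc_ring R S"

lemma loc_ring_simps:
  "carrier LR = carrier reg.LM" "add LR = add reg.LM" "ring.zero LR = ring.zero reg.LM"
  "\<one>\<^bsub>LR\<^esub> = reg.fr \<one> \<one>"
  by (simp_all add: loc_ring_def loc_module_def regular_module_simps)

lemma loc_ring_carrierE:
  assumes "A \<in> carrier LR"
  obtains a s where "a \<in> carrier R" "s \<in> S" "A = reg.fr a s"
  using assms by (auto simp: loc_ring_def)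

lemma loc_ring_frac_closed: "a \<in> carrier R \<Longrightarrow> s \<in> S \<Longrightarrow> reg.fr a s \<in> carrier LR"
  by (auto simp: loc_ring_def)

lemma loc_ring_mult:
  assumes "a \<in> carrier R" "s \<in> S" "b \<in> carrier R" "t \<in> S"
  shows "reg.fr a s \<otimes>\<^bsub>LR\<^esub> reg.fr b t = reg.fr (a \<otimes> b) (s \<otimes> t)"
  using reg.frac_smult[of a s b t] assms
  by (simp add: loc_ring_def loc_module_def regular_module_simps)

lemma loc_ring_add:
  assumes "a \<in> carrier R" "s \<in> S" "b \<in> carrier R" "t \<in> S"
  shows "reg.fr a s \<oplus>\<^bsub>LR\<^esub> reg.fr b t = reg.fr (t \<otimes> a \<oplus> s \<otimes> b) (s \<otimes> t)"
  using reg.frac_add[of a s b t] assms by (simp add: loc_ring_simps regular_module_simps)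

lemma loc_ring_frac_eqI:
  assumes "a \<in> carrier R" "s \<in> S" "b \<in> carrier R" "t \<in> S" "t \<otimes> a = s \<otimes> b"
  shows "reg.fr a s = reg.fr b t"
  using reg.frac_eqI[of a s b t] assms by (simp add: regular_module_simps)

lemma loc_ring_cring: "cring LR"
proof (rule cringI)
  interpret L: abelian_group reg.LM by (rule reg.loc_module_abelian_group)
  show "abelian_group LR"
    by (rule abelian_groupI) (auto simp: loc_ring_simps L.a_ac intro: L.l_neg)
  show "comm_monoid LR"
  proof (rule comm_monoidI)
    fix A B assume "A \<in> carrier LR" "B \<in> carrier LR"
    then obtain a s b t where *: "a \<in> carrier R" "s \<in> S" "A = reg.fr a s"
      "b \<in> carrier R" "t \<in> S" "B = reg.fr b t"
      by (elim loc_ring_carrierE) blast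
    then show "A \<otimes>\<^bsub>LR\<^esub> B \<in> carrier LR" "A \<otimes>\<^bsub>LR\<^esub> B = B \<otimes>\<^bsub>LR\<^esub> A"
      by (simp_all add: loc_ring_mult loc_ring_frac_closed mult_S m_comm)
  next
    fix A B C assume "A \<in> carrier LR" "B \<in> carrier LR" "C \<in> carrier LR"
    then obtain a s b t c r where *: "a \<in> carrier R" "s \<in> S" "A = reg.fr a s"
      "b \<in> carrier R" "t \<in> S" "B = reg.fr b t" "c \<in> carrier R" "r \<in> S" "C = reg.fr c r"
      by (elim loc_ring_carrierE) blast
    then show "A \<otimes>\<^bsub>LR\<^esub> B \<otimes>\<^bsub>LR\<^esub> C = A \<otimes>\<^bsub>LR\<^esub> (B \<otimes>\<^bsub>LR\<^esub> C)"
      by (simp add: loc_ring_mult mult_S m_assoc)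
  next
    fix A assume "A \<in> carrier LR"
    then show "\<one>\<^bsub>LR\<^esub> \<otimes>\<^bsub>LR\<^esub> A = A"
      by (elim loc_ring_carrierE) (simp add: loc_ring_simps(4) loc_ring_mult one_S)
  qed (simp add: loc_ring_simps(4) loc_ring_frac_closed one_S)
  fix A B C assume "A \<in> carrier LR" "B \<in> carrier LR" "C \<in> carrier LR"
  then obtain a s b t c r where *: "a \<in> carrier R" "s \<in> S" "A = reg.fr a s"
    "b \<in> carrier R" "t \<in> S" "B = reg.fr b t" "c \<in> carrier R" "r \<in> S" "C = reg.fr c r"
    by (elim loc_ring_carrierE) blast
  then show "(A \<oplus>\<^bsub>LR\<^esub> B) \<otimes>\<^bsub>LR\<^esub> C = A \<otimes>\<^bsub>LR\<^esub> C \<oplus>\<^bsub>LR\<^esub> B \<otimes>\<^bsub>LR\<^esub> C"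
    by (simp add: loc_ring_mult loc_ring_add mult_S, intro loc_ring_frac_eqI)
      (simp_all add: mult_S r_distr l_distr m_ac)
qed

end

lemma (in fraction_module) loc_module_module: "module LR LM"
proof (rule moduleI)
  fix A X assume "A \<in> carrier LR" "X \<in> carrier LM"
  then obtain a s x t where *: "a \<in> carrier R" "s \<in> S" "A = reg.fr a s"
    "x \<in> carrier M" "t \<in> S" "X = fr x t"
    by (elim loc_ring_carrierE loc_module_carrierE) blast
  then show "A \<odot>\<^bsub>LM\<^esub> X \<in> carrier LM" by (simp add: frac_smult mult_S)
next
  fix A B X assume "A \<in> carrier LR" "B \<in> carrier LR" "X \<in> carrier LM"
  then obtain a s b t x r where *: "a \<in> carrier R" "s \<in> S" "A = reg.fr a s"
    "b \<in> carrier R" "t \<in> S" "B = reg.fr b t" "x \<in> carrier M" "r \<in> S" "X = fr x r"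
    by (elim loc_ring_carrierE loc_module_carrierE) blast
  then show "A \<otimes>\<^bsub>LR\<^esub> B \<odot>\<^bsub>LM\<^esub> X = A \<odot>\<^bsub>LM\<^esub> (B \<odot>\<^bsub>LM\<^esub> X)"
    by (simp add: loc_ring_mult frac_smult mult_S smult_assoc1 m_assoc)
  show "(A \<oplus>\<^bsub>LR\<^esub> B) \<odot>\<^bsub>LM\<^esub> X = A \<odot>\<^bsub>LM\<^esub> X \<oplus>\<^bsub>LM\<^esub> B \<odot>\<^bsub>LM\<^esub> X"
    using * by (simp add: loc_ring_add frac_add frac_smult mult_S, intro frac_eqI)
      (simp_all add: mult_S smult_l_distr smult_r_distr smult_collect)
next
  fix A X Y assume "A \<in> carrier LR" "X \<in> carrier LM" "Y \<in> carrier LM"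
  then obtain a s x t y r where *: "a \<in> carrier R" "s \<in> S" "A = reg.fr a s"
    "x \<in> carrier M" "t \<in> S" "X = fr x t" "y \<in> carrier M" "r \<in> S" "Y = fr y r"
    by (elim loc_ring_carrierE loc_module_carrierE) blast
  then show "A \<odot>\<^bsub>LM\<^esub> (X \<oplus>\<^bsub>LM\<^esub> Y) = A \<odot>\<^bsub>LM\<^esub> X \<oplus>\<^bsub>LM\<^esub> A \<odot>\<^bsub>LM\<^esub> Y"
    by (simp add: frac_add frac_smult mult_S, intro frac_eqI)
      (simp_all add: mult_S smult_r_distr smult_collect)
next
  fix X assume "X \<in> carrier LM"
  then show "\<one>\<^bsub>LR\<^esub> \<odot>\<^bsub>LM\<^esub> X = X"
    by (elim loc_module_carrierE) (simp add: loc_ring_simps(4) frac_smult one_S)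
qed (simp_all add: loc_ring_cring loc_module_abelian_group)


section \<open>Localization at a prime\<close>

lemma (in primeideal) mult_set_compl: "mult_set R (carrier R - I)"
proof
  show "\<one> \<in> carrier R - I" using one_notin by simp
  show "s \<otimes> t \<in> carrier R - I" if "s \<in> carrier R - I" "t \<in> carrier R - I" for s t
    using that by (rule compl_mult)
qed blast

context primeideal
begin

interpretation at: mult_set R "carrier R - I" by (rule mult_set_compl)

lemma frac_mem_max_ideal_at_iff:
  assumes "a \<in> carrier R" "s \<in> carrier R - I"
  shows "at.reg.fr a s \<in> max_ideal_at R I \<longleftrightarrow> a \<in> I"
proof
  assume "at.reg.fr a s \<in> max_ideal_at R I"
  then obtain b t where b: "b \<in> I" "t \<in> carrier R - I" "at.reg.fr a s = at.reg.fr b t"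
    unfolding max_ideal_at_def by blast
  then obtain u where u: "u \<in> carrier R - I" "u \<otimes> (t \<otimes> a) = u \<otimes> (s \<otimes> b)"
    using at.reg.frac_eq_iff[of a s b t] assms by (auto simp: regular_module_simps)
  have "u \<otimes> (s \<otimes> b) \<in> I" using b u(1) assms by (simp add: I_l_closed)
  then have "(u \<otimes> t) \<otimes> a \<in> I" using u b(2) assms by (simp add: m_assoc)
  then show "a \<in> I" using I_prime[of "u \<otimes> t" a] at.mult_S[OF u(1) b(2)] assms by blast
qed (use assms in \<open>auto simp: max_ideal_at_def\<close>)

lemma max_ideal_at_ideal: "ideal (max_ideal_at R I) (ring_at R I)"
proof -
  interpret L: cring "ring_at R I" by (rule at.loc_ring_cring)
  have sub: "max_ideal_at R I \<subseteq> carrier (ring_at R I)"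
    unfolding max_ideal_at_def by (auto intro!: at.loc_ring_frac_closed)
  have mult: "A \<otimes>\<^bsub>ring_at R I\<^esub> X \<in> max_ideal_at R I"
    if A: "A \<in> carrier (ring_at R I)" and X: "X \<in> max_ideal_at R I" for A X
  proof -
    obtain a s x t where *: "a \<in> carrier R" "s \<in> carrier R - I" "A = at.reg.fr a s"
      "x \<in> I" "t \<in> carrier R - I" "X = at.reg.fr x t"
      using A X unfolding max_ideal_at_def by (elim at.loc_ring_carrierE) blast
    then have "A \<otimes>\<^bsub>ring_at R I\<^esub> X = at.reg.fr (a \<otimes> x) (s \<otimes> t)"
      using at.loc_ring_mult[of a s x t] by simp
    then show ?thesis
      using frac_mem_max_ideal_at_iff[OF _ at.mult_S[of s t]] * by (simp add: I_l_closed)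
  qed
  show ?thesis
  proof (rule idealI[OF L.ring_axioms])
    show "subgroup (max_ideal_at R I) (add_monoid (ring_at R I))"
    proof (rule L.add.subgroupI)
      show "max_ideal_at R I \<noteq> {}"
        using frac_mem_max_ideal_at_iff[OF zero_closed at.one_S] by auto
      fix X assume X: "X \<in> max_ideal_at R I"
      have "\<ominus>\<^bsub>ring_at R I\<^esub> X = (\<ominus>\<^bsub>ring_at R I\<^esub> \<one>\<^bsub>ring_at R I\<^esub>) \<otimes>\<^bsub>ring_at R I\<^esub> X"
        using X sub by (subst L.l_minus) auto
      then show "\<ominus>\<^bsub>ring_at R I\<^esub> X \<in> max_ideal_at R I" using mult[OF _ X] by simp
      fix Y assume "Y \<in> max_ideal_at R I"
      then obtain x s y t where *: "x \<in> I" "s \<in> carrier R - I" "X = at.reg.fr x s"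
        "y \<in> I" "t \<in> carrier R - I" "Y = at.reg.fr y t"
        using X unfolding max_ideal_at_def by blast
      then have "X \<oplus>\<^bsub>ring_at R I\<^esub> Y = at.reg.fr (t \<otimes> x \<oplus> s \<otimes> y) (s \<otimes> t)"
        using at.loc_ring_add[of x s y t] by simp
      moreover have "t \<otimes> x \<oplus> s \<otimes> y \<in> I" using * by (simp add: I_l_closed)
      ultimately show "X \<oplus>\<^bsub>ring_at R I\<^esub> Y \<in> max_ideal_at R I"
        using frac_mem_max_ideal_at_iff[OF _ at.mult_S[of s t]] * by simp
    qed (rule sub)
  next
    fix X A assume *: "X \<in> max_ideal_at R I" "A \<in> carrier (ring_at R I)"
    then show "A \<otimes>\<^bsub>ring_at R I\<^esub> X \<in> max_ideal_at R I" by (rule mult[rotated])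
    then show "X \<otimes>\<^bsub>ring_at R I\<^esub> A \<in> max_ideal_at R I" using * sub L.m_comm[of A X] by auto
  qed
qed

lemma one_notin_max_ideal_at: "\<one>\<^bsub>ring_at R I\<^esub> \<notin> max_ideal_at R I"
  unfolding at.loc_ring_simps(4)
  using frac_mem_max_ideal_at_iff[of \<one> \<one>] at.one_S by blast

lemma unit_at:
  assumes "A \<in> carrier (ring_at R I)" "A \<notin> max_ideal_at R I"
  shows "A \<in> Units (ring_at R I)"
proof -
  interpret L: cring "ring_at R I" by (rule at.loc_ring_cring)
  obtain a s where a: "a \<in> carrier R" "s \<in> carrier R - I" "A = at.reg.fr a s"
    using assms(1) by (elim at.loc_ring_carrierE)
  then have aI: "a \<in> carrier R - I" using assms(2) frac_mem_max_ideal_at_iff by blast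
  have "at.reg.fr s a \<otimes>\<^bsub>ring_at R I\<^esub> A = at.reg.fr (s \<otimes> a) (a \<otimes> s)"
    using a aI by (simp add: at.loc_ring_mult)
  also have "\<dots> = \<one>\<^bsub>ring_at R I\<^esub>"
    unfolding at.loc_ring_simps(4) using a aI at.mult_S[of a s] at.one_S
    by (intro at.loc_ring_frac_eqI) (auto simp: m_comm)
  finally show ?thesis
    using assms(1) at.loc_ring_frac_closed[of s a] a(2) aI L.m_comm[of A "at.reg.fr s a"]
    by (auto simp: Units_def)
qed

end

section \<open>Duals into the hull of the residue field\<close>

text \<open>Take \<open>e\<close> to be the image of \<open>1\<close> under the embedding of \<open>S / \<nn>\<close> into its hull.\<close>

lemma residue_in_hull:
  assumes "cring S" "ideal \<nn> S" "\<one>\<^bsub>S\<^esub> \<notin> \<nn>" "injective_hull S (quotient_module S \<nn>) E"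
  obtains e where "e \<in> carrier E" "e \<noteq> \<zero>\<^bsub>E\<^esub>" "\<And>a. a \<in> \<nn> \<Longrightarrow> a \<odot>\<^bsub>E\<^esub> e = \<zero>\<^bsub>E\<^esub>"
proof -
  interpret cring S by fact
  interpret n: ideal \<nn> S by fact
  interpret E: module S E using assms(4) by (simp add: injective_hull_def injective_module_def)
  let ?K = "quotient_module S \<nn>"
  have K: "carrier ?K = a_rcosets\<^bsub>S\<^esub> \<nn>" "smult ?K = (\<lambda>a X. (\<nn> +>\<^bsub>S\<^esub> a) \<otimes>\<^bsub>S Quot \<nn>\<^esub> X)"
    by (simp_all add: quotient_module_def ring.defs FactRing_def)
  have coset: "\<nn> +>\<^bsub>S\<^esub> a \<in> carrier ?K" if "a \<in> carrier S" for a
    unfolding K by (rule a_rcosetsI[OF n.a_subset that])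
  have sm: "a \<odot>\<^bsub>?K\<^esub> (\<nn> +>\<^bsub>S\<^esub> \<one>\<^bsub>S\<^esub>) = \<nn> +>\<^bsub>S\<^esub> a" if "a \<in> carrier S" for a
    unfolding K using that by (simp add: FactRing_def n.rcoset_mult_add)
  obtain \<phi> where \<phi>: "\<phi> \<in> Hom S ?K E" "inj_on \<phi> (carrier ?K)"
    using assms(4) unfolding injective_hull_def essential_embedding_def by blast
  define e where "e = \<phi> (\<nn> +>\<^bsub>S\<^esub> \<one>\<^bsub>S\<^esub>)"
  have ec: "e \<in> carrier E" using \<phi>(1) coset unfolding e_def Hom_def by auto
  have ae: "a \<odot>\<^bsub>E\<^esub> e = \<phi> (\<nn> +>\<^bsub>S\<^esub> a)" if "a \<in> carrier S" for a
  proof -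
    have "\<phi> (a \<odot>\<^bsub>?K\<^esub> (\<nn> +>\<^bsub>S\<^esub> \<one>\<^bsub>S\<^esub>)) = a \<odot>\<^bsub>E\<^esub> e"
      using \<phi>(1) coset[of "\<one>\<^bsub>S\<^esub>"] that unfolding Hom_def e_def by blast
    then show ?thesis using sm[OF that] by simp
  qed
  have ann: "a \<odot>\<^bsub>E\<^esub> e = \<zero>\<^bsub>E\<^esub>" if "a \<in> \<nn>" for a
    using ae[of a] ae[of "\<zero>\<^bsub>S\<^esub>"] that ec a_rcos_zero[OF n.is_ideal] by simp
  have "e \<noteq> \<zero>\<^bsub>E\<^esub>"
  proof
    assume "e = \<zero>\<^bsub>E\<^esub>"
    then have "\<phi> (\<nn> +>\<^bsub>S\<^esub> \<one>\<^bsub>S\<^esub>) = \<phi> (\<nn> +>\<^bsub>S\<^esub> \<zero>\<^bsub>S\<^esub>)"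
      using ae[of "\<zero>\<^bsub>S\<^esub>"] ec by (simp add: e_def)
    from inj_onD[OF \<phi>(2) this coset coset] have "\<nn> +>\<^bsub>S\<^esub> \<one>\<^bsub>S\<^esub> = \<nn>"
      using a_rcos_zero[OF n.is_ideal, of "\<zero>\<^bsub>S\<^esub>"] by simp
    then show False using n.rcos_const_imp_mem assms(3) by blast
  qed
  then show thesis using that ec ann by blast
qed

text \<open>The Matlis dual over a local ring is faithful. For \<open>z \<noteq> 0\<close> in \<open>N\<close>, the annihilator of \<open>z\<close> contains no
unit and so lies in \<open>\<nn>\<close>. With \<open>e\<close> as in \<open>residue_in_hull\<close>, the assignment
\<open>a z \<mapsto> a e\<close> is therefore a well-defined homomorphism on the submodule \<open>S z\<close>, nonzero at \<open>z\<close>, and it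
extends to \<open>N\<close> because \<open>E\<close> is injective.\<close>

lemma Hom_into_hull_nonzero_iff:
  assumes "cring S" "ideal \<nn> S" "\<one>\<^bsub>S\<^esub> \<notin> \<nn>"
    and units: "\<And>a. a \<in> carrier S \<Longrightarrow> a \<notin> \<nn> \<Longrightarrow> a \<in> Units S"
    and hull: "injective_hull S (quotient_module S \<nn>) E" and "module S N"
  shows "carrier (Hom_module S N E) \<noteq> {\<zero>\<^bsub>Hom_module S N E\<^esub>} \<longleftrightarrow> carrier N \<noteq> {\<zero>\<^bsub>N\<^esub>}"
proof
  interpret N: module S N by fact
  interpret E: module S E using hull by (simp add: injective_hull_def injective_module_def)
  have H: "carrier (Hom_module S N E) = Hom S N E" "\<zero>\<^bsub>Hom_module S N E\<^esub> = (\<lambda>x\<in>carrier N. \<zero>\<^bsub>E\<^esub>)"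
    by (simp_all add: Hom_module_def)
  {
    assume ne: "carrier (Hom_module S N E) \<noteq> {\<zero>\<^bsub>Hom_module S N E\<^esub>}"
    show "carrier N \<noteq> {\<zero>\<^bsub>N\<^esub>}"
    proof
      assume N: "carrier N = {\<zero>\<^bsub>N\<^esub>}"
      have "f = (\<lambda>x\<in>carrier N. \<zero>\<^bsub>E\<^esub>)" if f: "f \<in> Hom S N E" for f
      proof (rule extensionalityI[of _ "carrier N"])
        show "f \<in> extensional (carrier N)" using f by (auto simp: Hom_def PiE_def)
        fix x assume x: "x \<in> carrier N"
        have fc: "f \<zero>\<^bsub>N\<^esub> \<in> carrier E" using f by (auto simp: Hom_def)
        have "f (\<zero>\<^bsub>S\<^esub> \<odot>\<^bsub>N\<^esub> \<zero>\<^bsub>N\<^esub>) = \<zero>\<^bsub>S\<^esub> \<odot>\<^bsub>E\<^esub> f \<zero>\<^bsub>N\<^esub>"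
          using f unfolding Hom_def by blast
        then show "f x = (\<lambda>x\<in>carrier N. \<zero>\<^bsub>E\<^esub>) x" using x N fc by simp
      qed simp
      moreover have "(\<lambda>x\<in>carrier N. \<zero>\<^bsub>E\<^esub>) \<in> Hom S N E" by (auto simp: Hom_def)
      ultimately show False using ne unfolding H by blast
    qed
  }
  assume "carrier N \<noteq> {\<zero>\<^bsub>N\<^esub>}"
  then obtain z where z: "z \<in> carrier N" "z \<noteq> \<zero>\<^bsub>N\<^esub>" by blast
  obtain e where e: "e \<in> carrier E" "e \<noteq> \<zero>\<^bsub>E\<^esub>" "\<And>a. a \<in> \<nn> \<Longrightarrow> a \<odot>\<^bsub>E\<^esub> e = \<zero>\<^bsub>E\<^esub>"
    using residue_in_hull[OF assms(1-3) hull] by blast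
  have ann: "a \<in> \<nn>" if a: "a \<in> carrier S" "a \<odot>\<^bsub>N\<^esub> z = \<zero>\<^bsub>N\<^esub>" for a
  proof (rule ccontr)
    assume "a \<notin> \<nn>"
    then have u: "a \<in> Units S" using units a(1) by blast
    have "z = (inv\<^bsub>S\<^esub> a \<otimes>\<^bsub>S\<^esub> a) \<odot>\<^bsub>N\<^esub> z" using u z(1) by simp
    also have "\<dots> = inv\<^bsub>S\<^esub> a \<odot>\<^bsub>N\<^esub> (a \<odot>\<^bsub>N\<^esub> z)" using u z(1) a(1) by (intro N.smult_assoc1) auto
    also have "\<dots> = \<zero>\<^bsub>N\<^esub>" using a(2) u by simp
    finally show False using z(2) by blast
  qed
  have wd: "a \<odot>\<^bsub>E\<^esub> e = b \<odot>\<^bsub>E\<^esub> e"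
    if ab: "a \<in> carrier S" "b \<in> carrier S" "a \<odot>\<^bsub>N\<^esub> z = b \<odot>\<^bsub>N\<^esub> z" for a b
  proof -
    have "(a \<oplus>\<^bsub>S\<^esub> \<ominus>\<^bsub>S\<^esub> b) \<odot>\<^bsub>N\<^esub> z = \<zero>\<^bsub>N\<^esub>"
      using ab z by (simp add: N.smult_l_distr N.smult_l_minus N.M.r_neg)
    then have "(a \<oplus>\<^bsub>S\<^esub> \<ominus>\<^bsub>S\<^esub> b) \<odot>\<^bsub>E\<^esub> e = \<zero>\<^bsub>E\<^esub>" using ann ab e(3) by simp
    then have "a \<odot>\<^bsub>E\<^esub> e \<oplus>\<^bsub>E\<^esub> \<ominus>\<^bsub>E\<^esub> (b \<odot>\<^bsub>E\<^esub> e) = \<zero>\<^bsub>E\<^esub>"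
      using ab e(1) by (simp add: E.smult_l_distr E.smult_l_minus)
    then have "\<ominus>\<^bsub>E\<^esub> (\<ominus>\<^bsub>E\<^esub> (b \<odot>\<^bsub>E\<^esub> e)) = a \<odot>\<^bsub>E\<^esub> e"
      using ab e(1) by (intro E.M.minus_equality) auto
    then show ?thesis using ab e(1) by simp
  qed
  define Z where "Z = (\<lambda>a. a \<odot>\<^bsub>N\<^esub> z) ` carrier S"
  define g where "g = (\<lambda>w\<in>Z. (SOME a. a \<in> carrier S \<and> w = a \<odot>\<^bsub>N\<^esub> z) \<odot>\<^bsub>E\<^esub> e)"
  have g: "g (a \<odot>\<^bsub>N\<^esub> z) = a \<odot>\<^bsub>E\<^esub> e" if a: "a \<in> carrier S" for a
  proof -
    let ?b = "SOME b. b \<in> carrier S \<and> a \<odot>\<^bsub>N\<^esub> z = b \<odot>\<^bsub>N\<^esub> z"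
    have "?b \<in> carrier S \<and> a \<odot>\<^bsub>N\<^esub> z = ?b \<odot>\<^bsub>N\<^esub> z" by (rule someI[of _ a]) (simp add: a)
    then show ?thesis using wd[of ?b a] a by (simp add: g_def Z_def)
  qed
  have add: "a \<odot>\<^bsub>N\<^esub> z \<oplus>\<^bsub>N\<^esub> b \<odot>\<^bsub>N\<^esub> z = (a \<oplus>\<^bsub>S\<^esub> b) \<odot>\<^bsub>N\<^esub> z" if "a \<in> carrier S" "b \<in> carrier S" for a b
    using that z(1) by (simp add: N.smult_l_distr)
  have sm: "a \<odot>\<^bsub>N\<^esub> (b \<odot>\<^bsub>N\<^esub> z) = (a \<otimes>\<^bsub>S\<^esub> b) \<odot>\<^bsub>N\<^esub> z" if "a \<in> carrier S" "b \<in> carrier S" for a b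
    using that z(1) by (simp add: N.smult_assoc1)
  have "submodule Z S N"
  proof (rule N.submoduleI)
    show "Z \<subseteq> carrier N" using z(1) by (auto simp: Z_def)
    show "\<zero>\<^bsub>N\<^esub> \<in> Z" unfolding Z_def using z(1) by (intro image_eqI[of _ _ "\<zero>\<^bsub>S\<^esub>"]) auto
    show "\<ominus>\<^bsub>N\<^esub> w \<in> Z" if w: "w \<in> Z" for w
    proof -
      obtain a where a: "a \<in> carrier S" "w = a \<odot>\<^bsub>N\<^esub> z" using w unfolding Z_def by blast
      then have "\<ominus>\<^bsub>N\<^esub> w = (\<ominus>\<^bsub>S\<^esub> a) \<odot>\<^bsub>N\<^esub> z" using z(1) by (simp add: N.smult_l_minus)
      then show ?thesis unfolding Z_def by (rule image_eqI) (use a(1) in simp)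
    qed
  qed (auto simp: Z_def add sm)
  moreover have "g \<in> Hom S (N\<lparr>carrier := Z\<rparr>) E"
    unfolding Hom_def
  proof (intro CollectI conjI ballI)
    show "g \<in> carrier (N\<lparr>carrier := Z\<rparr>) \<rightarrow>\<^sub>E carrier E"
    proof (intro PiE_I)
      fix w assume "w \<in> carrier (N\<lparr>carrier := Z\<rparr>)"
      then show "g w \<in> carrier E" using e(1) g by (auto simp: Z_def)
    qed (simp add: g_def)
  qed (use z(1) e(1) in \<open>auto simp: Z_def add sm g E.smult_l_distr E.smult_assoc1\<close>)
  ultimately obtain h where h: "h \<in> Hom S N E" "\<And>x. x \<in> Z \<Longrightarrow> h x = g x"
    using injective_module_extends[of S E N Z g] hull \<open>module S N\<close>
    unfolding injective_hull_def by blast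
  have "z \<in> Z" unfolding Z_def using z(1) by (intro image_eqI[of _ _ "\<one>\<^bsub>S\<^esub>"]) auto
  then have "h z = e" using h(2) g[of "\<one>\<^bsub>S\<^esub>"] z(1) e(1) by simp
  then have "h \<noteq> (\<lambda>x\<in>carrier N. \<zero>\<^bsub>E\<^esub>)" using e(2) z(1) by auto
  then show "carrier (Hom_module S N E) \<noteq> {\<zero>\<^bsub>Hom_module S N E\<^esub>}" unfolding H using h(1) by blast
qed

lemma Hom_module_module:
  fixes M :: "('a, 'b, 'm) module_scheme" and E :: "('a, 'e, 'n) module_scheme"
  assumes "module R M" "module R E"
  shows "module R (Hom_module R M E)"
proof -
  interpret M: module R M by fact
  interpret E: module R E by fact
  let ?H = "Hom_module R M E"
  have H: "carrier ?H = Hom R M E" "\<zero>\<^bsub>?H\<^esub> = (\<lambda>x\<in>carrier M. \<zero>\<^bsub>E\<^esub>)"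
    "add ?H = (\<lambda>f g. \<lambda>x\<in>carrier M. f x \<oplus>\<^bsub>E\<^esub> g x)" "smult ?H = (\<lambda>a f. \<lambda>x\<in>carrier M. a \<odot>\<^bsub>E\<^esub> f x)"
    by (simp_all add: Hom_module_def)
  have cl: "f x \<in> carrier E" if "f \<in> Hom R M E" "x \<in> carrier M" for f x
    using that by (auto simp: Hom_def)
  have ad: "f (x \<oplus>\<^bsub>M\<^esub> y) = f x \<oplus>\<^bsub>E\<^esub> f y" if "f \<in> Hom R M E" "x \<in> carrier M" "y \<in> carrier M" for f x y
    using that by (auto simp: Hom_def)
  have sm: "f (a \<odot>\<^bsub>M\<^esub> x) = a \<odot>\<^bsub>E\<^esub> f x" if "f \<in> Hom R M E" "a \<in> carrier R" "x \<in> carrier M" for f a x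
    using that by (auto simp: Hom_def)
  have ext: "f = g" if "f \<in> extensional (carrier M)" "g \<in> extensional (carrier M)"
    "\<And>x. x \<in> carrier M \<Longrightarrow> f x = g x" for f g :: "'b \<Rightarrow> 'e"
    using that by (rule extensionalityI)
  have he: "f \<in> extensional (carrier M)" if "f \<in> Hom R M E" for f
    using that by (auto simp: Hom_def PiE_def)
  have HomI: "(\<lambda>x\<in>carrier M. F x) \<in> Hom R M E"
    if "\<And>x. x \<in> carrier M \<Longrightarrow> F x \<in> carrier E"
      "\<And>x y. x \<in> carrier M \<Longrightarrow> y \<in> carrier M \<Longrightarrow> F (x \<oplus>\<^bsub>M\<^esub> y) = F x \<oplus>\<^bsub>E\<^esub> F y"
      "\<And>a x. a \<in> carrier R \<Longrightarrow> x \<in> carrier M \<Longrightarrow> F (a \<odot>\<^bsub>M\<^esub> x) = a \<odot>\<^bsub>E\<^esub> F x" for F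
    using that by (auto simp: Hom_def)
  have smH: "(\<lambda>x\<in>carrier M. a \<odot>\<^bsub>E\<^esub> f x) \<in> Hom R M E" if "a \<in> carrier R" "f \<in> Hom R M E" for a f
    using that by (intro HomI)
      (auto simp: cl ad sm E.smult_r_distr E.smult_assoc1[symmetric] M.R.m_comm)
  show ?thesis
  proof (rule moduleI)
    show "abelian_group ?H"
    proof (rule abelian_groupI)
      show "f \<oplus>\<^bsub>?H\<^esub> g \<in> carrier ?H" if "f \<in> carrier ?H" "g \<in> carrier ?H" for f g
        using that unfolding H by (intro HomI) (auto simp: cl ad sm E.smult_r_distr E.M.a_ac)
      show "\<zero>\<^bsub>?H\<^esub> \<in> carrier ?H" unfolding H by (intro HomI) auto
      show "f \<oplus>\<^bsub>?H\<^esub> g \<oplus>\<^bsub>?H\<^esub> h = f \<oplus>\<^bsub>?H\<^esub> (g \<oplus>\<^bsub>?H\<^esub> h)"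
        if "f \<in> carrier ?H" "g \<in> carrier ?H" "h \<in> carrier ?H" for f g h
        using that unfolding H by (intro ext) (auto simp: cl E.M.a_assoc)
      show "f \<oplus>\<^bsub>?H\<^esub> g = g \<oplus>\<^bsub>?H\<^esub> f" if "f \<in> carrier ?H" "g \<in> carrier ?H" for f g
        using that unfolding H by (intro ext) (auto simp: cl E.M.a_comm)
      show "\<zero>\<^bsub>?H\<^esub> \<oplus>\<^bsub>?H\<^esub> f = f" if "f \<in> carrier ?H" for f
        using that unfolding H by (intro ext) (auto simp: cl he)
      show "\<exists>g\<in>carrier ?H. g \<oplus>\<^bsub>?H\<^esub> f = \<zero>\<^bsub>?H\<^esub>" if f: "f \<in> carrier ?H" for f
      proof
        show "(\<ominus>\<^bsub>R\<^esub> \<one>\<^bsub>R\<^esub>) \<odot>\<^bsub>?H\<^esub> f \<in> carrier ?H" using f smH unfolding H by simp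
        show "(\<ominus>\<^bsub>R\<^esub> \<one>\<^bsub>R\<^esub>) \<odot>\<^bsub>?H\<^esub> f \<oplus>\<^bsub>?H\<^esub> f = \<zero>\<^bsub>?H\<^esub>"
          using f unfolding H by (intro ext) (auto simp: cl E.smult_l_minus E.M.l_neg)
      qed
    qed
    show "a \<odot>\<^bsub>?H\<^esub> f \<in> carrier ?H" if "a \<in> carrier R" "f \<in> carrier ?H" for a f
      using that smH unfolding H by simp
    show "(a \<oplus>\<^bsub>R\<^esub> b) \<odot>\<^bsub>?H\<^esub> f = a \<odot>\<^bsub>?H\<^esub> f \<oplus>\<^bsub>?H\<^esub> b \<odot>\<^bsub>?H\<^esub> f"
      if "a \<in> carrier R" "b \<in> carrier R" "f \<in> carrier ?H" for a b f
      using that unfolding H by (intro ext) (auto simp: cl E.smult_l_distr)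
    show "a \<odot>\<^bsub>?H\<^esub> (f \<oplus>\<^bsub>?H\<^esub> g) = a \<odot>\<^bsub>?H\<^esub> f \<oplus>\<^bsub>?H\<^esub> a \<odot>\<^bsub>?H\<^esub> g"
      if "a \<in> carrier R" "f \<in> carrier ?H" "g \<in> carrier ?H" for a f g
      using that unfolding H by (intro ext) (auto simp: cl E.smult_r_distr)
    show "a \<otimes>\<^bsub>R\<^esub> b \<odot>\<^bsub>?H\<^esub> f = a \<odot>\<^bsub>?H\<^esub> (b \<odot>\<^bsub>?H\<^esub> f)"
      if "a \<in> carrier R" "b \<in> carrier R" "f \<in> carrier ?H" for a b f
      using that unfolding H by (intro ext) (auto simp: cl E.smult_assoc1)
    show "\<one>\<^bsub>R\<^esub> \<odot>\<^bsub>?H\<^esub> f = f" if "f \<in> carrier ?H" for f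
      using that unfolding H by (intro ext) (auto simp: cl he)
  qed (rule M.R.is_cring)
qed


section \<open>Cosupport\<close>

text \<open>The cosupport of \<open>M\<close> is the support of its Matlis dual: the outer dual in the definition of
colocalization can be dropped, because it is faithful.\<close>

lemma mem_CoSupp_iff:
  assumes "module R M" "module R E" "P \<in> Spec R"
    and hull: "injective_hull (ring_at R P) (quotient_module (ring_at R P) (max_ideal_at R P)) (F P)"
  shows "P \<in> CoSupp R E F M \<longleftrightarrow>
    (\<exists>f\<in>carrier (matlis_dual R E M). \<forall>s\<in>prime_compl R P. s \<odot>\<^bsub>matlis_dual R E M\<^esub> f \<noteq> \<zero>\<^bsub>matlis_dual R E M\<^esub>)"
proof -
  interpret P: primeideal P R using assms(3) by (simp add: Spec_def)
  let ?D = "matlis_dual R E M"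
  interpret fraction_module R "prime_compl R P" ?D
    unfolding matlis_dual_def
    by (intro fraction_module.intro P.mult_set_compl Hom_module_module assms)
  have "matlis_dual LR (F P) LM = Hom_module LR LM (F P)" by (rule matlis_dual_def)
  then have "P \<in> CoSupp R E F M \<longleftrightarrow> carrier LM \<noteq> {\<zero>\<^bsub>LM\<^esub>}"
    unfolding CoSupp_def colocalization_def
    using Hom_into_hull_nonzero_iff[OF loc_ring_cring P.max_ideal_at_ideal P.one_notin_max_ideal_at
        P.unit_at hull loc_module_module] assms(3) by simp
  then show ?thesis unfolding loc_module_nonzero_iff .
qed

theorem lemma4p2:
  fixes R :: "('a, 'r) ring_scheme"
    and \<mm> :: "'a set"
    and M :: "('a, 'b, 'm) module_scheme"
    and E :: "('a, 'e, 'n) module_scheme"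
    and F :: "'a set \<Rightarrow> (('a \<times> 'a) set, 'f, 'l) module_scheme"
  assumes "noetherian_ring R"
    and "local_ring R \<mm>"
    and "module R M"
    and "injective_hull R (quotient_module R \<mm>) E"
    and "\<And>P. P \<in> Spec R \<Longrightarrow>
           injective_hull (ring_at R P) (quotient_module (ring_at R P) (max_ideal_at R P)) (F P)"
  shows "finite (minimal_primes (CoSupp R E F M)) \<longleftrightarrow> closedin (zariski R) (CoSupp R E F M)"
proof -
  interpret cring R using assms(2) by (simp add: local_ring_def)
  interpret noetherian_cring R
    by (intro noetherian_cring.intro assms(1) cring_axioms)
  have E: "module R E" using assms(4) by (simp add: injective_hull_def injective_module_def)
  have sub: "CoSupp R E F M \<subseteq> Spec R" by (auto simp: CoSupp_def)
  have up: "Q \<in> CoSupp R E F M" if P: "P \<in> CoSupp R E F M" and Q: "Q \<in> Spec R" "P \<subseteq> Q" for P Q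
  proof -
    have "P \<in> Spec R" using P sub by blast
    from mem_CoSupp_iff[where F = F, OF assms(3) E this assms(5)[OF this]]
      mem_CoSupp_iff[where F = F, OF assms(3) E Q(1) assms(5)[OF Q(1)]]
    show ?thesis using P Q(2) by blast
  qed
  show ?thesis using sub up by (rule finite_minimal_primes_iff_closedin)
qed

end
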